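(* Let $\mathcal{F}=\{f_i\}_{i=1}^n$ be a frame for $\mathbb{C}^d$ with (positive definite) frame operator $S_{\mathcal{F}}$. Let $0<\delta<1$ and let $s>0$ satisfy $(1-\delta)^d\le s\le(1+\delta)^d$. Set $\lambda=(\log\lambda_i(S_{\mathcal{F}}))_{i=1}^d$, $t=\log\big(\frac{s\cdot\det S_{\mathcal{F}}}{(1-\delta)^d}\big)$ and $\varepsilon=\log\big(\frac{1+\delta}{1-\delta}\big)$. Let $\rho=\rho_{(t,\varepsilon)}(\lambda,0)$ (see context) and $\mu=\big((1-\delta)\,e^{\rho_i}\big)_{i=1}^d$. Let $h:[0,\infty)\to[0,\infty)$ be an increasing convex function. Then: 1. For every $V\cdot\mathcal{F}\in\mathcal{P}_{(s,\delta)}(\mathcal{F})$, $$P_h(V\cdot\mathcal{F})\ge\sum_{i=1}^d h(\mu_i),$$ and this lower bound is attained. 2. Assume further that $h$ is strictly convex. Then $V\cdot\mathcal{F}\in\mathcal{P}_{(s,\delta)}(\mathcal{F})$ attains the lower bound in item 1 if and only if $\det(V^*V)=s$ and there exists an orthonormal basis $\{v_i\}_{i=1}^d$ of $\mathbb{C}^d$ such that $$S_{\mathcal{F}}=\sum_{i=1}^d\lambda_i(S_{\mathcal{F}})\,v_i\otimes v_i\quad\text{and}\quad VV^*=\sum_{i=1}^d\frac{\mu_i}{\lambda_i(S_{\mathcal{F}})}\,v_i\otimes v_i .$$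
   Context: For a finite sequence $\mathcal{F}=\{f_i\}_{i=1}^n$ in $\mathbb{C}^d$, the frame operator is $S_{\mathcal{F}}=\sum_{i=1}^n f_i\otimes f_i$, where $(x\otimes y)(z)=\langle z,y\rangle x$. $\mathcal{F}$ is a frame for $\mathbb{C}^d$ iff it spans $\mathbb{C}^d$. The convex potential associated with $h$ is $P_h(\mathcal{F})=\operatorname{tr}h(S_{\mathcal{F}})=\sum_{i=1}^d h(\lambda_i(S_{\mathcal{F}}))$. For an invertible $d\times d$ complex matrix $V$, $V\cdot\mathcal{F}=\{Vf_i\}_{i=1}^n$, and $$\mathcal{P}_{(s,\delta)}(\mathcal{F})=\{V\cdot\mathcal{F}:\ V\text{ invertible},\ \|V^*V-I\|\le\delta,\ \det(V^*V)\ge s\}$$ with $\|\cdot\|$ the spectral norm. For a positive semidefinite $d\times d$ matrix $S$, $\lambda(S)=(\lambda_i(S))_{i=1}^d$ is the vector of eigenvalues counted with multiplicity in non-increasing order. For $x\in\mathbb{R}^d$, $x^\downarrow$ (resp. $x^\uparrow$) is its rearrangement in non-increasing (resp. non-decreasing) order and $\operatorname{tr}x=\sum_i x_i$. Submajorization: $x\prec_w y$ means $\sum_{i=1}^k x_i^\downarrow\le\sum_{i=1}^k y_i^\downarrow$ for all $1\le k\le d$. For $\lambda\in\mathbb{R}^d$ with $\lambda=\lambda^\downarrow$, $\varepsilon>0$ and $t\ge\operatorname{tr}\lambda$ with $t-\operatorname{tr}\lambda\le d\cdot\varepsilon$, let $$\Lambda_{(t,\varepsilon)}(\lambda,0)=\{\lambda+\mu:\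 \mu\in\mathbb{R}^d,\ 0\le\mu_i\le\varepsilon\ \forall i,\ \operatorname{tr}\mu\ge t-\operatorname{tr}\lambda\}.$$ The vector $\rho_{(t,\varepsilon)}(\lambda,0)$ denotes the unique $\rho\in\Lambda_{(t,\varepsilon)}(\lambda,0)$ such that $\operatorname{tr}\rho=t$, $\rho\prec_w\gamma$ for every $\gamma\in\Lambda_{(t,\varepsilon)}(\lambda,0)$, and $\rho-\lambda=(\rho-\lambda)^\uparrow$ (such a $\rho$ exists, is unique, and is itself non-increasing).
   Formalization: In item 2 the formal statement has V*V = Σ (μ_i/λ_i(S_F)) v_i⊗v_i in place of VV*; as printed both directions fail, e.g. S_F = diag(4,1), δ = 1/2, s = 3/4, h(x) = x², V = UD or DU with U the coordinate swap, D = diag(√(1/2), √(3/2)). *)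

theory Defs
  imports "HOL-Analysis.Analysis" "HOL-Computational_Algebra.Polynomial"
begin

text \<open>
  The space \<open>\<complex>\<^sup>d\<close> is \<^typ>\<open>complex^'d\<close> with \<open>d = CARD('d)\<close>. Finite sequences of vectors and
  vectors in \<open>\<real>\<^sup>d\<close> whose coordinates are ordered \<open>1, \<dots>, d\<close> are lists (indexed from 0).
\<close>

subsection \<open>Vectors and matrices\<close>

definition cinner :: "complex^'d \<Rightarrow> complex^'d \<Rightarrow> complex" where
  "cinner x y = (\<Sum>i\<in>UNIV. x $ i * cnj (y $ i))"

definition ctranspose :: "complex^'n^'m \<Rightarrow> complex^'m^'n" where
  "ctranspose A = (\<chi> i j. cnj (A $ j $ i))"

definition tensor :: "complex^'d \<Rightarrow> complex^'d \<Rightarrow> complex^'d^'d" where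
  "tensor x y = (\<chi> i j. x $ i * cnj (y $ j))"

lemma tensor_mult_vec: "tensor x y *v z = cinner z y *s x"
  by (simp add: tensor_def cinner_def matrix_vector_mult_def vec_eq_iff sum_distrib_left
        sum_distrib_right mult_ac)

text \<open>The norm on \<^typ>\<open>complex^'d\<close> is the Hermitian one, so this is the spectral norm.\<close>

definition spectral_norm :: "complex^'d^'d \<Rightarrow> real" where
  "spectral_norm A = onorm (\<lambda>x. A *v x)"

definition is_onb :: "(complex^'d) list \<Rightarrow> bool" where
  "is_onb vs \<longleftrightarrow> length vs = CARD('d) \<and>
     (\<forall>i<length vs. \<forall>j<length vs. cinner (vs ! i) (vs ! j) = (if i = j then 1 else 0)) \<and>
     vec.span (set vs) = UNIV"

subsection \<open>Eigenvalues\<close>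

definition charpoly :: "complex^'d^'d \<Rightarrow> complex poly" where
  "charpoly A = det (\<chi> i j. (if i = j then [:0, 1:] else 0) - [:A $ i $ j:])"

definition decr :: "real list \<Rightarrow> real list" where
  "decr x = rev (sort x)"

text \<open>
  For a positive semidefinite (more generally, Hermitian) \<open>S\<close> the roots of the characteristic
  polynomial are real, so \<^const>\<open>Re\<close> only converts types; the multiset \<^const>\<open>proots\<close> takes
  multiplicities into account. On non-Hermitian matrices the definition is not meaningful.
\<close>

definition eigvals :: "complex^'d^'d \<Rightarrow> real list" where
  "eigvals S = rev (sorted_list_of_multiset (image_mset Re (proots (charpoly S))))"

subsection \<open>Frames, convex potentials, perturbations\<close>

definition frame_op :: "(complex^'d) list \<Rightarrow> complex^'d^'d" where
  "frame_op F = (\<Sum>f\<leftarrow>F. tensor f f)"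

definition is_frame :: "(complex^'d) list \<Rightarrow> bool" where
  "is_frame F \<longleftrightarrow> vec.span (set F) = UNIV"

definition convex_potential :: "(real \<Rightarrow> real) \<Rightarrow> (complex^'d) list \<Rightarrow> real" where
  "convex_potential h F = (\<Sum>x\<leftarrow>eigvals (frame_op F). h x)"

definition act :: "complex^'d^'d \<Rightarrow> (complex^'d) list \<Rightarrow> (complex^'d) list" where
  "act V F = map (\<lambda>f. V *v f) F"

text \<open>
  \<open>V\<^sup>*V\<close> is positive semidefinite, so its determinant is real and \<^const>\<open>Re\<close> loses nothing.
\<close>

definition perturbations :: "real \<Rightarrow> real \<Rightarrow> (complex^'d) list \<Rightarrow> (complex^'d) list set" where
  "perturbations s \<delta> F =
     {act V F | V. invertible V \<and> spectral_norm (ctranspose V ** V - mat 1) \<le> \<delta> \<and>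
                   Re (det (ctranspose V ** V)) \<ge> s}"

text \<open>
  The operator \<open>S\<close> of \<open>F\<close> becomes \<open>V S V\<^sup>*\<close>, which has the same eigenvalues as
  \<open>S\<^sup>1\<^sup>/\<^sup>2 V\<^sup>*V S\<^sup>1\<^sup>/\<^sup>2\<close>. Thus the spectrum depends on \<open>V\<close> only through \<open>V\<^sup>*V\<close>
  (replacing \<open>V\<close> by \<open>U V\<close> with \<open>U\<close> unitary changes \<open>V V\<^sup>*\<close> but not the potential), and optimal
  \<open>V\<close> are to be characterised by a condition on \<open>V\<^sup>*V\<close>, not on \<open>V V\<^sup>*\<close>.
\<close>

lemma tensor_matrix_vector_mult: "tensor (V *v x) (V *v y) = V ** tensor x y ** ctranspose V"
  by (simp add: tensor_def ctranspose_def matrix_matrix_mult_def matrix_vector_mult_def vec_eq_iff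
        sum_product sum_distrib_right sum_distrib_left mult_ac)

lemma frame_op_act:
  fixes V :: "complex^'d^'d"
  shows "frame_op (act V F) = V ** frame_op F ** ctranspose V"
proof (induction F)
  case Nil
  show ?case by (simp add: frame_op_def act_def matrix_matrix_mult_def vec_eq_iff)
next
  case (Cons f F)
  have "(A + B) ** C = A ** C + B ** C" for A B C :: "complex^'d^'d"
    by (simp add: matrix_matrix_mult_def vec_eq_iff distrib_right sum.distrib)
  with Cons show ?case
    by (simp add: frame_op_def act_def tensor_matrix_vector_mult matrix_add_ldistrib)
qed

subsection \<open>Submajorization and the optimal vector\<close>

definition submajorized :: "real list \<Rightarrow> real list \<Rightarrow> bool" where
  "submajorized x y \<longleftrightarrow> length x = length y \<and>
     (\<forall>k\<in>{1..length x}. sum_list (take k (decr x)) \<le> sum_list (take k (decr y)))"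

definition Lambda_set :: "real \<Rightarrow> real \<Rightarrow> real list \<Rightarrow> real list set" where
  "Lambda_set t \<epsilon> lam =
     {map2 (+) lam m | m. length m = length lam \<and> (\<forall>i<length m. 0 \<le> m ! i \<and> m ! i \<le> \<epsilon>) \<and>
                          sum_list m \<ge> t - sum_list lam}"

text \<open>
  Meaningful for non-increasing \<open>lam\<close>, \<open>\<epsilon> > 0\<close> and
  \<open>0 \<le> t - sum_list lam \<le> length lam * \<epsilon>\<close>, where exactly one such vector exists.
\<close>

definition rho_opt :: "real \<Rightarrow> real \<Rightarrow> real list \<Rightarrow> real list" where
  "rho_opt t \<epsilon> lam =
     (THE r. r \<in> Lambda_set t \<epsilon> lam \<and> sum_list r = t \<and>
             (\<forall>g\<in>Lambda_set t \<epsilon> lam. submajorized r g) \<and>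
             sort (map2 (-) r lam) = map2 (-) r lam)"

subsection \<open>Strict convexity\<close>

definition strictly_convex_on :: "real set \<Rightarrow> (real \<Rightarrow> real) \<Rightarrow> bool" where
  "strictly_convex_on A f \<longleftrightarrow> convex A \<and>
     (\<forall>x\<in>A. \<forall>y\<in>A. \<forall>u>0. \<forall>v>0. x \<noteq> y \<longrightarrow> u + v = 1 \<longrightarrow>
        f (u * x + v * y) < u * f x + v * f y)"

end

theory Submission
  imports Defs
begin

text \<open>
  Write \<open>S\<close> for the frame operator, \<open>S v\<^sub>i = \<lambda>\<^sub>i v\<^sub>i\<close> for an orthonormal eigenbasis, and \<open>A = V\<^sup>*V\<close>. The
  perturbed frame operator \<open>V S V\<^sup>*\<close> has the same characteristic polynomial as
  \<open>T = S\<^sup>1\<^sup>/\<^sup>2 A S\<^sup>1\<^sup>/\<^sup>2\<close>. The proof compares three sequences: the eigenvalues of \<open>T\<close>, its diagonal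
  \<open>d\<^sub>i = \<langle>T v\<^sub>i, v\<^sub>i\<rangle> = \<lambda>\<^sub>i \<langle>A v\<^sub>i, v\<^sub>i\<rangle>\<close> in the eigenbasis of \<open>S\<close>, and the vector \<open>\<mu>\<close>.

  Diagonal against eigenvalues. Each \<open>d\<^sub>i\<close> is an average of the eigenvalues of \<open>T\<close> with doubly
  stochastic weights, so Jensen's inequality gives \<open>\<Sum> h(d\<^sub>i) \<le> tr h(T)\<close>; for \<open>h = - ln\<close> this is
  Hadamard's inequality \<open>det T \<le> \<Prod> d\<^sub>i\<close>. If \<open>h\<close> is strictly convex, equality
  forces \<open>T v\<^sub>i = d\<^sub>i v\<^sub>i\<close> for all \<open>i\<close>. These facts come from the identity
  \<open>sum_eigvals_minus_sum_diag\<close>.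

  Diagonal against \<open>\<mu>\<close>. The constraints on \<open>V\<close> say that \<open>d\<^sub>i\<close> lies between \<open>(1 - \<delta>) \<lambda>\<^sub>i\<close> and
  \<open>(1 + \<delta>) \<lambda>\<^sub>i\<close>, and, by Hadamard, that \<open>\<Sum> ln d\<^sub>i \<ge> ln s + \<Sum> ln \<lambda>\<^sub>i\<close>. The vector \<open>\<mu>\<close> arises by water
  filling: it is a common level \<open>C\<close> clipped to these intervals, with equality in the constraint on
  the logarithms (\<open>rho_opt_eq_water\<close>, \<open>optimal_spectrum\<close>). Hence \<open>\<mu>\<^sub>i\<close> lies between \<open>C\<close> and \<open>d\<^sub>i\<close>, and
  comparing slopes with a tangent of \<open>h\<close> at \<open>C\<close> yields \<open>\<Sum> h(\<mu>\<^sub>i) \<le> \<Sum> h(d\<^sub>i)\<close>, with equality only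
  for \<open>d = \<mu>\<close> when \<open>h\<close> is strictly convex (\<open>sum_convex_log_le\<close>).

  Together these give the lower bound. In the case of equality \<open>T v\<^sub>i = \<mu>\<^sub>i v\<^sub>i\<close>, that is,
  \<open>A v\<^sub>i = (\<mu>\<^sub>i / \<lambda>\<^sub>i) v\<^sub>i\<close>, and then \<open>det A = \<Prod> \<mu>\<^sub>i / \<lambda>\<^sub>i = s\<close>. Conversely, any \<open>V\<close> with such a \<open>V\<^sup>*V\<close>
  makes \<open>T\<close> diagonal with entries \<open>\<mu>\<^sub>i\<close>, which shows that the bound is attained.
\<close>

section \<open>Tangent lines of convex functions\<close>

text \<open>
  Slopes of chords of a convex function grow to the right. A chord from \<open>a\<close> to \<open>b\<close> pointing away from
  \<open>c\<close> is therefore at least as steep, in that direction, as a tangent at \<open>c\<close>. This one-sided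
  comparison is the mechanism behind the comparisons of convex sums: the optimal value always sits
  between a fixed point \<open>c\<close> and its competitor.
\<close>

lemma convex_on_tangent_slope:
  fixes g :: "real \<Rightarrow> real"
  assumes g: "convex_on I g"
    and tangent: "\<And>x. x \<in> I \<Longrightarrow> g c + m * (x - c) \<le> g x"
    and I: "c \<in> I" "a \<in> I" "b \<in> I"
    and between: "c \<le> a \<and> a \<le> b \<or> b \<le> a \<and> a \<le> c"
  shows "m * (b - a) \<le> g b - g a"
proof (cases "a = c \<or> a = b")
  case True
  then show ?thesis using tangent[OF I(3)] by auto
next
  case False
  \<comment> \<open>The weight with which \<open>a\<close> is a convex combination of \<open>c\<close> and \<open>b\<close>.\<close>
  define u where "u = (a - c) / (b - c)"
  have bc: "b \<noteq> c" using False between by auto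
  have u: "0 < u" "u < 1"
    using False between unfolding u_def by (auto simp: field_simps)
  have ac: "a - c = u * (b - c)" using bc by (simp add: u_def)
  have "g ((1 - u) *\<^sub>R c + u *\<^sub>R b) \<le> (1 - u) * g c + u * g b"
    using convex_onD[OF g] u I by auto
  moreover have "(1 - u) *\<^sub>R c + u *\<^sub>R b = a" using ac by (simp add: algebra_simps)
  ultimately have le: "g a \<le> (1 - u) * g c + u * g b" by simp
  have "(1 - u) * g c \<le> (1 - u) * (g a - m * (a - c))"
    using tangent[OF I(2)] u by (intro mult_left_mono) auto
  with le have "u * (g b - g a) \<ge> (1 - u) * (m * (a - c))" by (simp add: algebra_simps)
  moreover have "(1 - u) * (m * (a - c)) = u * (m * (b - a))"
  proof -
    have "b - a = (1 - u) * (b - c)" using ac by (simp add: algebra_simps)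
    then show ?thesis using ac by simp
  qed
  ultimately show ?thesis using u by simp
qed

text \<open>
  The non-strict bound for the half chord from \<open>a\<close> to the midpoint, which still points away from \<open>c\<close>,
  combined with strict convexity at the midpoint.
\<close>

lemma strictly_convex_on_tangent_slope:
  fixes g :: "real \<Rightarrow> real"
  assumes g: "convex_on I g" and strict: "strictly_convex_on I g"
    and tangent: "\<And>x. x \<in> I \<Longrightarrow> g c + m * (x - c) \<le> g x"
    and I: "c \<in> I" "a \<in> I" "b \<in> I"
    and between: "c \<le> a \<and> a \<le> b \<or> b \<le> a \<and> a \<le> c"
    and "a \<noteq> b"
  shows "m * (b - a) < g b - g a"
proof -
  let ?z = "1/2 * a + 1/2 * b"
  have "\<And>x y u v. x\<in>I \<Longrightarrow> y\<in>I \<Longrightarrow> u>0 \<Longrightarrow> v>0 \<Longrightarrow> x \<noteq> y \<Longrightarrow> u + v = 1 \<Longrightarrow>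
        g (u * x + v * y) < u * g x + v * g y"
    using strict unfolding strictly_convex_on_def by blast
  from this[of a b "1/2" "1/2"] have mid: "g ?z < 1/2 * g a + 1/2 * g b"
    using I \<open>a \<noteq> b\<close> by simp
  have zI: "?z \<in> I"
    using g I convexD[of I a b "1/2" "1/2"] by (auto simp: convex_on_def)
  have "m * (?z - a) \<le> g ?z - g a"
    using between by (intro convex_on_tangent_slope[OF g tangent I(1,2) zI]) auto
  with mid show ?thesis by (simp add: algebra_simps)
qed

lemma convex_on_obtains_tangent:
  fixes g :: "real \<Rightarrow> real"
  assumes "convex_on {0..} g" and "0 < c"
  obtains m where "\<And>x. x \<in> {0..} \<Longrightarrow> g c + m * (x - c) \<le> g x"
proof -
  have "c \<in> interior {0..}" using assms(2) by (simp add: interior_real_atLeast)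
  from convex_le_Inf_differential[OF assms(1) this] show ?thesis by (rule that)
qed

section \<open>Water filling\<close>

text \<open>
  The level \<open>c\<close> clipped to the interval from \<open>a\<close> to \<open>a + e\<close>: the height reached in a column with bottom
  \<open>a\<close> and capacity \<open>e\<close> when the water stands at level \<open>c\<close>.
\<close>

definition water_fill :: "real \<Rightarrow> real \<Rightarrow> real \<Rightarrow> real" where
  "water_fill e c a = max a (min (a + e) c)"

text \<open>
  Clipping is the projection of \<open>c\<close> onto the interval, so it separates \<open>c\<close> from every competitor in
  the interval.
\<close>

lemma water_between:
  assumes "a \<le> x" "x \<le> a + e"
  shows "c \<le> water_fill e c a \<and> water_fill e c a \<le> x \<or> x \<le> water_fill e c a \<and> water_fill e c a \<le> c"
  using assms by (auto simp: water_fill_def max_def min_def)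

lemma water_bounds: "0 \<le> e \<Longrightarrow> a \<le> water_fill e c a" "0 \<le> e \<Longrightarrow> water_fill e c a \<le> a + e"
  by (auto simp: water_fill_def)

lemma water_increment_antimono:
  assumes "0 \<le> e" "a \<le> b"
  shows "water_fill e c b - b \<le> water_fill e c a - a"
  using assms by (auto simp: water_fill_def max_def min_def)

lemma obtains_water_level:
  fixes lam :: "real list" and e t :: real
  assumes "0 \<le> e" "lam \<noteq> []" "sum_list lam \<le> t" "t \<le> sum_list lam + length lam * e"
  obtains c where "sum_list (map (water_fill e c) lam) = t"
proof -
  let ?f = "\<lambda>c. sum_list (map (water_fill e c) lam)"
  \<comment> \<open>At the lowest bottom every column is empty, at the highest top every column is full.\<close>
  let ?lo = "Min (set lam)" and ?hi = "Max (set lam) + e"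
  have "continuous_on {?lo..?hi} ?f"
    unfolding sum_list_sum_nth water_fill_def by (auto intro!: continuous_intros)
  moreover have "?f ?lo = sum_list lam"
  proof -
    have "map (water_fill e ?lo) lam = lam"
      using assms(1) by (intro map_idI) (auto simp: water_fill_def max_def min_def dest: Min_le[rotated])
    then show ?thesis by simp
  qed
  moreover have "?f ?hi = sum_list lam + length lam * e"
  proof -
    have "map (water_fill e ?hi) lam = map (\<lambda>a. a + e) lam"
      using assms(1) by (intro map_cong refl) (auto simp: water_fill_def max_def min_def dest: Max_ge[rotated])
    then have "?f ?hi = (\<Sum>a\<leftarrow>lam. a + e)" by (rule arg_cong)
    then show ?thesis by (simp add: sum_list_addf sum_list_triv)
  qed
  moreover have "?lo \<le> ?hi"
  proof -
    have "?lo \<le> Max (set lam)" using assms(2) by (metis List.finite_set Max_in Min_le set_empty)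
    then show ?thesis using assms(1) by simp
  qed
  ultimately obtain c where "?f c = t"
    using IVT'[of ?f ?lo t ?hi] assms(3,4) by auto
  then show ?thesis using that by blast
qed

text \<open>
  Among all choices from the intervals with total at least that of the clipped levels, the clipped
  levels minimise the sum of \<open>g\<close> for every convex \<open>g\<close> with a tangent of non-negative slope at \<open>c\<close>: the
  tangent converts a larger total into a larger sum. Applied to positive parts this is submajorization.
\<close>

lemma sum_water_le:
  fixes x a :: "'i \<Rightarrow> real"
  assumes g: "convex_on UNIV g"
    and tangent: "\<And>x. g c + m * (x - c) \<le> g x" and m: "0 \<le> m"
    and x: "\<And>i. i \<in> A \<Longrightarrow> a i \<le> x i \<and> x i \<le> a i + e"
    and total: "(\<Sum>i\<in>A. water_fill e c (a i)) \<le> (\<Sum>i\<in>A. x i)"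
  shows "(\<Sum>i\<in>A. g (water_fill e c (a i))) \<le> (\<Sum>i\<in>A. g (x i))"
proof -
  have "0 \<le> m * ((\<Sum>i\<in>A. x i) - (\<Sum>i\<in>A. water_fill e c (a i)))"
    using m total by simp
  also have "\<dots> = (\<Sum>i\<in>A. m * (x i - water_fill e c (a i)))"
    by (simp add: sum_distrib_left sum_subtractf algebra_simps)
  also have "\<dots> \<le> (\<Sum>i\<in>A. g (x i) - g (water_fill e c (a i)))"
    using x by (intro sum_mono convex_on_tangent_slope[OF g tangent] water_between) auto
  finally show ?thesis by (simp add: sum_subtractf)
qed

text \<open>
  The Pythagorean inequality for projection onto a box, seen from the centre \<open>(c, \<dots>, c)\<close>. It makes the
  clipped vector the only point of the box with its own value of \<open>\<Sum> (x\<^sub>i - c)\<^sup>2\<close> or a smaller one; as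
  this sum is unaffected by rearrangement, uniqueness of the optimal vector follows.
\<close>

lemma sum_squares_water_le:
  fixes x a :: "'i \<Rightarrow> real"
  assumes x: "\<And>i. i \<in> A \<Longrightarrow> a i \<le> x i \<and> x i \<le> a i + e"
  shows "(\<Sum>i\<in>A. (water_fill e c (a i) - c)\<^sup>2) + (\<Sum>i\<in>A. (x i - water_fill e c (a i))\<^sup>2) \<le> (\<Sum>i\<in>A. (x i - c)\<^sup>2)"
  unfolding sum.distrib[symmetric]
proof (rule sum_mono)
  fix i assume "i \<in> A"
  let ?r = "water_fill e c (a i)"
  have "0 \<le> (x i - ?r) * (?r - c)"
    using water_between[of "a i" "x i" e c] x[OF \<open>i \<in> A\<close>]
    by (auto intro: mult_nonneg_nonneg mult_nonpos_nonpos)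
  then show "(?r - c)\<^sup>2 + (x i - ?r)\<^sup>2 \<le> (x i - c)\<^sup>2"
    by (simp add: power2_eq_square algebra_simps)
qed

section \<open>Submajorization and the optimal vector\<close>

lemma length_decr [simp]: "length (decr x) = length x"
  and mset_decr [simp]: "mset (decr x) = mset x"
  by (simp_all add: decr_def)

lemma sum_list_map_mset_cong:
  fixes f :: "'a \<Rightarrow> real"
  assumes "mset x = mset y"
  shows "sum_list (map f x) = sum_list (map f y)"
  using arg_cong[OF assms, of "\<lambda>M. \<Sum>v\<in>#M. f v"] by (simp flip: sum_mset_sum_list)

lemma sum_list_map_decr: "sum_list (map f (decr x)) = sum_list (map f x)"
  for f :: "real \<Rightarrow> real"
  by (rule sum_list_map_mset_cong) simp

lemma sum_list_decr_upt: "(\<Sum>x\<leftarrow>decr (map m [0..<n]). h x) = (\<Sum>i<n. h (m i))"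
  for h :: "real \<Rightarrow> real"
  unfolding sum_list_map_decr by (simp add: atLeast0LessThan o_def sum_list_sum_nth)

lemma decr_nth_mono: "i \<le> j \<Longrightarrow> j < length x \<Longrightarrow> decr x ! j \<le> decr x ! i"
  by (simp add: decr_def rev_nth sorted_nth_mono)

text \<open>
  The sum of the \<open>k\<close> largest entries is the minimum over \<open>c\<close> of \<open>k c + \<Sum> (v - c)\<^sup>+\<close>, attained at the
  \<open>k\<close>-th largest entry. This lemma is the upper bound, \<open>sum_take_decr_eq_threshold\<close> the attainment;
  together they reduce submajorization to positive parts.
\<close>

lemma sum_take_le_threshold:
  fixes y :: "real list"
  assumes "k \<le> length y"
  shows "sum_list (take k y) \<le> k * c + (\<Sum>v\<leftarrow>y. max (v - c) 0)"
proof -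
  have "sum_list (take k y) \<le> (\<Sum>v\<leftarrow>take k y. c + max (v - c) 0)"
    using sum_list_mono[of "take k y" "\<lambda>v. v" "\<lambda>v. c + max (v - c) 0"] by simp
  also have "\<dots> = k * c + (\<Sum>v\<leftarrow>take k y. max (v - c) 0)"
    using assms by (simp add: sum_list_addf sum_list_triv)
  also have "\<dots> \<le> k * c + (\<Sum>v\<leftarrow>take k y @ drop k y. max (v - c) 0)"
    unfolding map_append sum_list_append
    using sum_list_nonneg[of "map (\<lambda>v. max (v - c) 0) (drop k y)"] by force
  finally show ?thesis by simp
qed

lemma sum_take_decr_eq_threshold:
  assumes "1 \<le> k" "k \<le> length x"
  shows "sum_list (take k (decr x)) = k * (decr x ! (k - 1)) + (\<Sum>v\<leftarrow>decr x. max (v - decr x ! (k - 1)) 0)"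
proof -
  let ?y = "decr x" and ?c = "decr x ! (k - 1)"
  have "(\<Sum>v\<leftarrow>take k ?y. max (v - ?c) 0) = (\<Sum>v\<leftarrow>take k ?y. v - ?c)"
  proof (intro arg_cong[of _ _ sum_list] map_cong refl)
    fix v assume "v \<in> set (take k ?y)"
    then obtain i where "i < k" "v = ?y ! i" using assms by (auto simp: in_set_conv_nth)
    then show "max (v - ?c) 0 = v - ?c"
      using decr_nth_mono[of i "k - 1" x] assms by auto
  qed
  moreover have "(\<Sum>v\<leftarrow>drop k ?y. max (v - ?c) 0) = (\<Sum>v\<leftarrow>drop k ?y. 0)"
  proof (intro arg_cong[of _ _ sum_list] map_cong refl)
    fix v assume "v \<in> set (drop k ?y)"
    then obtain i where "i < length x - k" "v = ?y ! (k + i)"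
      using assms by (auto simp: in_set_conv_nth)
    then show "max (v - ?c) 0 = 0"
      using decr_nth_mono[of "k - 1" "k + i" x] assms by auto
  qed
  ultimately have "(\<Sum>v\<leftarrow>take k ?y @ drop k ?y. max (v - ?c) 0) = (\<Sum>v\<leftarrow>take k ?y. v - ?c)"
    unfolding map_append sum_list_append by simp
  also have "\<dots> = sum_list (take k ?y) - k * ?c"
    using assms by (simp add: sum_list_subtractf sum_list_triv)
  finally show ?thesis by simp
qed

lemma submajorizedI:
  assumes len: "length x = length y"
    and le: "\<And>c. (\<Sum>v\<leftarrow>x. max (v - c) 0) \<le> (\<Sum>v\<leftarrow>y. max (v - c) 0)"
  shows "submajorized x y"
  unfolding submajorized_def
proof (intro conjI ballI len)
  fix k assume k: "k \<in> {1..length x}"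
  let ?c = "decr y ! (k - 1)"
  have "sum_list (take k (decr x)) \<le> k * ?c + (\<Sum>v\<leftarrow>decr x. max (v - ?c) 0)"
    using k by (intro sum_take_le_threshold) auto
  also have "\<dots> \<le> k * ?c + (\<Sum>v\<leftarrow>decr y. max (v - ?c) 0)"
    using le[of ?c] by (simp add: sum_list_map_decr)
  also have "\<dots> = sum_list (take k (decr y))"
    using k len by (intro sum_take_decr_eq_threshold[symmetric]) auto
  finally show "sum_list (take k (decr x)) \<le> sum_list (take k (decr y))" .
qed

lemma submajorized_antisym_mset:
  assumes "submajorized x y" "submajorized y x"
  shows "mset x = mset y"
proof -
  have len: "length x = length y" using assms(1) by (simp add: submajorized_def)
  have eq: "sum_list (take k (decr x)) = sum_list (take k (decr y))" if "k \<le> length x" for k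
  proof (cases "k = 0")
    case False
    then have "k \<in> {1..length x}" "k \<in> {1..length y}" using that len by auto
    with assms show ?thesis unfolding submajorized_def by (intro antisym) blast+
  qed simp
  have "decr x = decr y"
  proof (rule nth_equalityI)
    fix i assume "i < length (decr x)"
    then show "decr x ! i = decr y ! i"
      using eq[of i] eq[of "Suc i"] len by (simp add: take_Suc_conv_app_nth)
  qed (simp add: len)
  then show ?thesis by (metis mset_decr)
qed

lemma Lambda_set_nth:
  assumes "g \<in> Lambda_set t e lam"
  shows "length g = length lam" "t \<le> sum_list g"
    "\<And>i. i < length lam \<Longrightarrow> lam ! i \<le> g ! i \<and> g ! i \<le> lam ! i + e"
proof -
  obtain m where m: "g = map2 (+) lam m" "length m = length lam"
      "\<forall>i<length m. 0 \<le> m ! i \<and> m ! i \<le> e" "sum_list m \<ge> t - sum_list lam"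
    using assms by (auto simp: Lambda_set_def)
  show "length g = length lam" using m by simp
  have "sum_list g = sum_list lam + sum_list m"
    using m by (simp add: sum_list_sum_nth sum.distrib)
  then show "t \<le> sum_list g" using m by simp
  show "lam ! i \<le> g ! i \<and> g ! i \<le> lam ! i + e" if "i < length lam" for i
    using m that by auto
qed

lemma Lambda_setI:
  assumes "length g = length lam" "t \<le> sum_list g"
    and "\<And>i. i < length lam \<Longrightarrow> lam ! i \<le> g ! i \<and> g ! i \<le> lam ! i + e"
  shows "g \<in> Lambda_set t e lam"
proof -
  have "g = map2 (+) lam (map2 (-) g lam)"
    using assms(1) by (intro nth_equalityI) auto
  moreover have "sum_list (map2 (-) g lam) = sum_list g - sum_list lam"
    using assms(1) by (simp add: sum_list_sum_nth sum_subtractf)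
  ultimately show ?thesis
    unfolding Lambda_set_def using assms by (intro CollectI exI[of _ "map2 (-) g lam"]) (auto simp: algebra_simps)
qed

lemma convex_on_positive_part: "convex_on UNIV (\<lambda>v::real. max (v - c) 0)"
proof (rule convex_onI)
  fix t x y :: real assume t: "0 < t" "t < 1"
  have "(1 - t) * (x - c) \<le> (1 - t) * max (x - c) 0" "t * (y - c) \<le> t * max (y - c) 0"
    using t by (auto intro!: mult_left_mono)
  moreover have "0 \<le> (1 - t) * max (x - c) 0" "0 \<le> t * max (y - c) 0"
    using t by auto
  ultimately show "max ((1 - t) *\<^sub>R x + t *\<^sub>R y - c) 0 \<le> (1 - t) * max (x - c) 0 + t * max (y - c) 0"
    by (simp add: max_def algebra_simps split: if_splits)
qed simp

text \<open>
  The clipped vector is submajorized by every element of \<open>\<Lambda>\<close> because it minimises all sums of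
  positive parts. Any other element with this property is a rearrangement of it, hence has the same
  sum of squares around \<open>c\<close>, hence equals it.
\<close>

lemma rho_opt_eq_water:
  fixes lam :: "real list"
  assumes e: "0 \<le> e" and decreasing: "sorted_wrt (\<ge>) lam"
    and level: "sum_list (map (water_fill e c) lam) = t"
  shows "rho_opt t e lam = map (water_fill e c) lam"
proof -
  let ?r = "map (water_fill e c) lam"
  have in_Lambda: "?r \<in> Lambda_set t e lam"
    using level water_bounds[OF e] by (intro Lambda_setI) auto
  have least: "submajorized ?r g" if g: "g \<in> Lambda_set t e lam" for g
  proof (rule submajorizedI)
    fix c'
    have "(\<Sum>i<length lam. max (water_fill e c (lam ! i) - c') 0) \<le> (\<Sum>i<length lam. max (g ! i - c') 0)"
    proof (rule sum_water_le)
      show "convex_on UNIV (\<lambda>v. max (v - c') 0)" by (rule convex_on_positive_part)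
      \<comment> \<open>At the kink \<open>c = c'\<close> every slope between \<open>0\<close> and \<open>1\<close> is that of a tangent.\<close>
      show "max (c - c') 0 + (if c' < c then 1 else 0) * (x - c) \<le> max (x - c') 0" for x
        by auto
      show "(\<Sum>i<length lam. water_fill e c (lam ! i)) \<le> (\<Sum>i<length lam. g ! i)"
        using level Lambda_set_nth(1,2)[OF g] by (simp add: sum_list_sum_nth atLeast0LessThan)
    qed (use Lambda_set_nth(3)[OF g] in auto)
    then show "(\<Sum>v\<leftarrow>?r. max (v - c') 0) \<le> (\<Sum>v\<leftarrow>g. max (v - c') 0)"
      using Lambda_set_nth(1)[OF g] by (simp add: sum_list_sum_nth atLeast0LessThan)
  qed (use Lambda_set_nth[OF g] in auto)
  have "map2 (-) ?r lam = map (\<lambda>a. water_fill e c a - a) lam"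
    by (intro nth_equalityI) auto
  moreover have "sorted (map (\<lambda>a. water_fill e c a - a) lam)"
    using decreasing water_increment_antimono[OF e, of _ _ c]
    unfolding sorted_wrt_map by (rule sorted_wrt_mono_rel[rotated])
  ultimately have increments: "sort (map2 (-) ?r lam) = map2 (-) ?r lam"
    by (simp add: sorted_sort_id)
  show ?thesis unfolding rho_opt_def
  proof (rule the_equality)
    fix r assume r: "r \<in> Lambda_set t e lam \<and> sum_list r = t \<and>
      (\<forall>g\<in>Lambda_set t e lam. submajorized r g) \<and> sort (map2 (-) r lam) = map2 (-) r lam"
    then have r: "r \<in> Lambda_set t e lam" and "submajorized r ?r"
      using in_Lambda by blast+
    note nth = Lambda_set_nth[OF r]
    from \<open>submajorized r ?r\<close> have "mset r = mset ?r"
      using least[OF r] by (rule submajorized_antisym_mset)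
    then have "sum_list (map (\<lambda>v. (v - c)\<^sup>2) r) = sum_list (map (\<lambda>v. (v - c)\<^sup>2) ?r)"
      by (rule sum_list_map_mset_cong)
    then have "(\<Sum>i<length lam. (r ! i - c)\<^sup>2) = (\<Sum>i<length lam. (water_fill e c (lam ! i) - c)\<^sup>2)"
      using nth(1) by (simp add: sum_list_sum_nth atLeast0LessThan)
    moreover have "(\<Sum>i<length lam. (water_fill e c (lam ! i) - c)\<^sup>2) + (\<Sum>i<length lam. (r ! i - water_fill e c (lam ! i))\<^sup>2)
        \<le> (\<Sum>i<length lam. (r ! i - c)\<^sup>2)"
      using nth(3) by (intro sum_squares_water_le) auto
    ultimately have "(\<Sum>i<length lam. (r ! i - water_fill e c (lam ! i))\<^sup>2) \<le> 0" by linarith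
    then have "(\<Sum>i<length lam. (r ! i - water_fill e c (lam ! i))\<^sup>2) = 0"
      by (intro antisym sum_nonneg) auto
    then have "\<forall>i<length lam. r ! i = water_fill e c (lam ! i)"
      by (subst (asm) sum_nonneg_eq_0_iff) auto
    then show "r = ?r" using nth(1) by (intro nth_equalityI) auto
  next
    show "?r \<in> Lambda_set t e lam \<and> sum_list ?r = t \<and>
      (\<forall>g\<in>Lambda_set t e lam. submajorized ?r g) \<and> sort (map2 (-) ?r lam) = map2 (-) ?r lam"
      using in_Lambda least level increments by blast
  qed
qed

section \<open>Water filling under a logarithmic constraint\<close>

text \<open>
  Water filling in multiplicative form. With \<open>k \<ge> 0\<close> the slope of a tangent of \<open>h\<close> at \<open>c\<close>, the two slope
  comparisons \<open>h (x i) - h (y i) \<ge> k (x i - y i)\<close> and \<open>x i - y i \<ge> c (ln (x i) - ln (y i))\<close> both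
  hold because \<open>y i\<close> lies between \<open>c\<close> and \<open>x i\<close>; monotonicity of \<open>h\<close> is what makes \<open>k\<close> non-negative.
\<close>

lemma sum_convex_log_le:
  fixes x y :: "'i \<Rightarrow> real"
  assumes h: "convex_on {0..} h" "mono_on {0..} h" and c: "0 < c"
    and pos: "\<And>i. i \<in> A \<Longrightarrow> 0 < x i \<and> 0 < y i"
    and between: "\<And>i. i \<in> A \<Longrightarrow> c \<le> y i \<and> y i \<le> x i \<or> x i \<le> y i \<and> y i \<le> c"
    and logs: "(\<Sum>i\<in>A. ln (y i)) \<le> (\<Sum>i\<in>A. ln (x i))"
  shows "(\<Sum>i\<in>A. h (y i)) \<le> (\<Sum>i\<in>A. h (x i))"
    and "\<lbrakk>finite A; strictly_convex_on {0..} h; (\<Sum>i\<in>A. h (x i)) = (\<Sum>i\<in>A. h (y i)); i \<in> A\<rbrakk> \<Longrightarrow> x i = y i"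
proof -
  obtain k where tangent: "\<And>x. x \<in> {0..} \<Longrightarrow> h c + k * (x - c) \<le> h x"
    using convex_on_obtains_tangent[OF h(1) c] by blast
  \<comment> \<open>Evaluating the tangent at \<open>0\<close>: monotonicity gives it a non-negative slope.\<close>
  have "h 0 \<le> h c" using mono_onD[OF h(2), of 0 c] c by simp
  with tangent[of 0] have "0 \<le> k * c" by simp
  then have k: "0 \<le> k" using c by (simp add: zero_le_mult_iff)
  have termwise: "c * (ln (x i) - ln (y i)) \<le> x i - y i" if i: "i \<in> A" for i
  proof -
    have "ln (x i) - ln (y i) = ln (x i / y i)" using pos[OF i] by (simp add: ln_div)
    also have "\<dots> \<le> x i / y i - 1" using pos[OF i] by (intro ln_le_minus_one) simp
    also have "\<dots> = (x i - y i) / y i" using pos[OF i] by (simp add: field_simps)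
    also have "\<dots> \<le> (x i - y i) / c"
      using between[OF i]
    proof
      assume "c \<le> y i \<and> y i \<le> x i"
      then show ?thesis using c by (intro divide_left_mono) auto
    next
      assume "x i \<le> y i \<and> y i \<le> c"
      then show ?thesis using c pos[OF i] by (intro divide_left_mono_neg) auto
    qed
    finally show ?thesis using c by (simp add: field_simps)
  qed
  have "0 \<le> c * ((\<Sum>i\<in>A. ln (x i)) - (\<Sum>i\<in>A. ln (y i)))" using c logs by simp
  also have "\<dots> = (\<Sum>i\<in>A. c * (ln (x i) - ln (y i)))"
    by (simp add: sum_distrib_left sum_subtractf algebra_simps)
  also have "\<dots> \<le> (\<Sum>i\<in>A. x i - y i)" by (intro sum_mono termwise)
  finally have "0 \<le> k * (\<Sum>i\<in>A. x i - y i)" using k by simp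
  then have nonneg: "0 \<le> (\<Sum>i\<in>A. k * (x i - y i))" by (simp add: sum_distrib_left)
  have slope: "k * (x i - y i) \<le> h (x i) - h (y i)" if "i \<in> A" for i
    using c pos[OF that] by (intro convex_on_tangent_slope[OF h(1) tangent _ _ _ between[OF that]]) auto
  have "(\<Sum>i\<in>A. k * (x i - y i)) \<le> (\<Sum>i\<in>A. h (x i) - h (y i))" by (intro sum_mono slope)
  with nonneg show "(\<Sum>i\<in>A. h (y i)) \<le> (\<Sum>i\<in>A. h (x i))" by (simp add: sum_subtractf)
  assume A: "finite A" and strict: "strictly_convex_on {0..} h"
    and eq: "(\<Sum>i\<in>A. h (x i)) = (\<Sum>i\<in>A. h (y i))" and i: "i \<in> A"
  show "x i = y i"
  proof (rule ccontr)
    assume "x i \<noteq> y i"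
    then have "k * (x i - y i) < h (x i) - h (y i)"
      using c pos[OF i]
      by (intro strictly_convex_on_tangent_slope[OF h(1) strict tangent _ _ _ between[OF i]]) auto
    then have "(\<Sum>i\<in>A. k * (x i - y i)) < (\<Sum>i\<in>A. h (x i) - h (y i))"
      using slope i by (intro sum_strict_mono_ex1 A) auto
    with nonneg eq show False by (simp add: sum_subtractf)
  qed
qed

text \<open>
  In the variables \<open>ln x - ln (1 - \<delta>)\<close>, the interval from \<open>(1 - \<delta>) e\<^sub>i\<close> to \<open>(1 + \<delta>) e\<^sub>i\<close> becomes the one
  from \<open>ln e\<^sub>i\<close> to \<open>ln e\<^sub>i + \<epsilon>\<close>, and the bounds on \<open>s\<close> say that some water level realises the total \<open>t\<close>.
  Exponentiating back, \<open>\<mu>\<close> is a constant \<open>C\<close> clipped to the original intervals. The properties listed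
  are all that the comparison with other spectra uses.
\<close>

lemma optimal_spectrum:
  fixes e lam \<rho> \<mu> :: "real list"
  assumes e: "e \<noteq> []" "sorted_wrt (\<ge>) e" "\<And>i. i < length e \<Longrightarrow> 0 < e ! i"
    and \<delta>: "0 < \<delta>" "\<delta> < 1"
    and s: "0 < s" "(1 - \<delta>) ^ length e \<le> s" "s \<le> (1 + \<delta>) ^ length e"
    and lam: "lam = map ln e"
    and t: "t = ln (s * (\<Prod>i<length e. e ! i) / (1 - \<delta>) ^ length e)"
    and \<epsilon>: "\<epsilon> = ln ((1 + \<delta>) / (1 - \<delta>))"
    and \<rho>: "\<rho> = rho_opt t \<epsilon> lam"
    and \<mu>: "\<mu> = map (\<lambda>r. (1 - \<delta>) * exp r) \<rho>"
  obtains C where "0 < C" "length \<mu> = length e"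
    "\<And>i. i < length e \<Longrightarrow> (1 - \<delta>) * e ! i \<le> \<mu> ! i \<and> \<mu> ! i \<le> (1 + \<delta>) * e ! i"
    "\<And>i x. i < length e \<Longrightarrow> (1 - \<delta>) * e ! i \<le> x \<Longrightarrow> x \<le> (1 + \<delta>) * e ! i \<Longrightarrow>
        C \<le> \<mu> ! i \<and> \<mu> ! i \<le> x \<or> x \<le> \<mu> ! i \<and> \<mu> ! i \<le> C"
    "(\<Sum>i<length e. ln (\<mu> ! i)) = ln s + (\<Sum>i<length e. ln (e ! i))"
proof -
  have \<epsilon>_eq: "\<epsilon> = ln (1 + \<delta>) - ln (1 - \<delta>)" using \<delta> by (simp add: \<epsilon> ln_div)
  have \<epsilon>_nonneg: "0 \<le> \<epsilon>" using \<delta> by (simp add: \<epsilon>_eq)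
  have sum_lam: "sum_list lam = (\<Sum>i<length e. ln (e ! i))"
    by (simp add: lam sum_list_sum_nth atLeast0LessThan)
  have t_eq: "t = ln s + sum_list lam - length e * ln (1 - \<delta>)"
  proof -
    have pos: "0 < (\<Prod>i<length e. e ! i)" using e(3) by (intro prod_pos) auto
    have "ln (\<Prod>i<length e. e ! i) = (\<Sum>i<length e. ln (e ! i))"
      using e(3) by (intro ln_prod) (auto simp: less_imp_neq[symmetric])
    moreover have "t = ln (s * (\<Prod>i<length e. e ! i)) - ln ((1 - \<delta>) ^ length e)"
      unfolding t using pos \<delta> s(1) by (intro ln_divide_pos) auto
    ultimately show ?thesis
      using \<delta> s(1) pos by (simp add: sum_lam ln_mult_pos ln_realpow)
  qed
  have "length e * ln (1 - \<delta>) = ln ((1 - \<delta>) ^ length e)" using \<delta> by (simp add: ln_realpow)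
  also have "\<dots> \<le> ln s" using \<delta> s by simp
  finally have lower: "sum_list lam \<le> t" by (simp add: t_eq)
  have "ln s \<le> ln ((1 + \<delta>) ^ length e)" using \<delta> s by simp
  also have "\<dots> = length e * ln (1 + \<delta>)" using \<delta> by (simp add: ln_realpow)
  finally have upper: "t \<le> sum_list lam + length lam * \<epsilon>"
    by (simp add: t_eq \<epsilon>_eq lam algebra_simps)
  obtain c where c: "sum_list (map (water_fill \<epsilon> c) lam) = t"
    using obtains_water_level[OF \<epsilon>_nonneg _ lower upper] e(1) lam by auto
  have "sorted_wrt (\<ge>) lam" unfolding lam sorted_wrt_map
    using e(2,3) by (auto simp: sorted_wrt_iff_nth_less)
  then have \<rho>_eq: "\<rho> = map (water_fill \<epsilon> c) lam"
    unfolding \<rho> by (rule rho_opt_eq_water[OF \<epsilon>_nonneg _ c])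
  have \<mu>_nth: "\<mu> ! i = (1 - \<delta>) * exp (water_fill \<epsilon> c (ln (e ! i)))" if "i < length e" for i
    using that by (simp add: \<mu> \<rho>_eq lam)
  have \<mu>_log: "\<mu> ! i = exp (ln (1 - \<delta>) + water_fill \<epsilon> c (ln (e ! i)))" if "i < length e" for i
    using \<delta> by (simp add: \<mu>_nth[OF that] exp_add)
  define C where "C = exp (ln (1 - \<delta>) + c)"
  show ?thesis
  proof (rule that[of C])
    show "0 < C" by (simp add: C_def)
    show "length \<mu> = length e" by (simp add: \<mu> \<rho>_eq lam)
    show "(1 - \<delta>) * e ! i \<le> \<mu> ! i \<and> \<mu> ! i \<le> (1 + \<delta>) * e ! i" if i: "i < length e" for i
    proof -
      have "(1 - \<delta>) * e ! i = exp (ln (1 - \<delta>) + ln (e ! i))"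
        "(1 + \<delta>) * e ! i = exp (ln (1 - \<delta>) + (ln (e ! i) + \<epsilon>))"
        using \<delta> e(3)[OF i] by (simp_all add: exp_add \<epsilon>_eq exp_diff)
      then show ?thesis
        using water_bounds[OF \<epsilon>_nonneg] unfolding \<mu>_log[OF i] by simp
    qed
    show "C \<le> \<mu> ! i \<and> \<mu> ! i \<le> x \<or> x \<le> \<mu> ! i \<and> \<mu> ! i \<le> C"
      if i: "i < length e" and x: "(1 - \<delta>) * e ! i \<le> x" "x \<le> (1 + \<delta>) * e ! i" for i x
    proof -
      have "0 < (1 - \<delta>) * e ! i" using \<delta> e(3)[OF i] by simp
      then have pos: "0 < x" using x by linarith
      have "ln ((1 - \<delta>) * e ! i) \<le> ln x" "ln x \<le> ln ((1 + \<delta>) * e ! i)"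
        using x pos \<open>0 < (1 - \<delta>) * e ! i\<close> by (auto intro!: ln_mono)
      then have "ln (e ! i) \<le> ln x - ln (1 - \<delta>)" "ln x - ln (1 - \<delta>) \<le> ln (e ! i) + \<epsilon>"
        using \<delta> e(3)[OF i] by (simp_all add: ln_mult_pos \<epsilon>_eq)
      moreover have "x = exp (ln (1 - \<delta>) + (ln x - ln (1 - \<delta>)))" using pos by simp
      ultimately obtain y where "ln (e ! i) \<le> y" "y \<le> ln (e ! i) + \<epsilon>" "x = exp (ln (1 - \<delta>) + y)"
        by blast
      with water_between[of "ln (e ! i)" y \<epsilon> c] show ?thesis
        unfolding \<mu>_log[OF i] C_def by simp
    qed
    have "(\<Sum>i<length e. ln (\<mu> ! i)) = length e * ln (1 - \<delta>) + (\<Sum>i<length e. water_fill \<epsilon> c (ln (e ! i)))"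
      by (simp add: \<mu>_log sum.distrib)
    also have "(\<Sum>i<length e. water_fill \<epsilon> c (ln (e ! i))) = t"
      using c by (simp add: lam sum_list_sum_nth atLeast0LessThan)
    finally show "(\<Sum>i<length e. ln (\<mu> ! i)) = ln s + (\<Sum>i<length e. ln (e ! i))"
      by (simp add: t_eq sum_lam)
  qed
qed

section \<open>The Hermitian inner product and adjoints\<close>

lemma cinner_left_simps:
  fixes x y z :: "complex^'d"
  shows "cinner (x + y) z = cinner x z + cinner y z"
    "cinner (x - y) z = cinner x z - cinner y z"
    "cinner (c *s x) z = c * cinner x z"
    "cinner (r *\<^sub>R x) z = of_real r * cinner x z"
    "cinner 0 z = 0"
  by (simp_all add: cinner_def sum.distrib sum_subtractf algebra_simps sum_distrib_left scaleR_conv_of_real[where 'a=complex])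

lemma cnj_cinner: "cnj (cinner x y) = cinner y x"
  by (simp add: cinner_def mult.commute)

lemma cinner_right_simps:
  fixes x y z :: "complex^'d"
  shows "cinner z (x + y) = cinner z x + cinner z y"
    "cinner z (x - y) = cinner z x - cinner z y"
    "cinner z (c *s x) = cnj c * cinner z x"
    "cinner z (r *\<^sub>R x) = of_real r * cinner z x"
    "cinner z 0 = 0"
  by (simp_all add: cinner_def sum.distrib sum_subtractf algebra_simps sum_distrib_left scaleR_conv_of_real[where 'a=complex])

lemmas cinner_simps = cinner_left_simps cinner_right_simps

lemma cinner_sum_left: "cinner (\<Sum>i\<in>I. f i) z = (\<Sum>i\<in>I. cinner (f i) z)"
  by (induction I rule: infinite_finite_induct) (simp_all add: cinner_simps)

lemma cinner_self: "cinner x x = of_real ((norm x)\<^sup>2)"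
  by (simp add: cinner_def norm_vec_def L2_set_def sum_nonneg complex_norm_square del: of_real_power)

lemma cinner_self_eq_0_iff: "cinner x x = 0 \<longleftrightarrow> x = 0"
  by (simp add: cinner_self)

lemma norm_cinner_le: "cmod (cinner x y) \<le> norm x * norm y"
proof -
  have "cmod (cinner x y) \<le> (\<Sum>i\<in>UNIV. cmod (x $ i) * cmod (y $ i))"
    unfolding cinner_def by (rule order_trans[OF norm_sum]) (simp add: norm_mult)
  also have "\<dots> \<le> norm x * norm y"
    unfolding norm_vec_def using L2_set_mult_ineq[of "\<lambda>i. cmod (x $ i)" "\<lambda>i. cmod (y $ i)" UNIV] by simp
  finally show ?thesis .
qed

lemma matrix_vector_mult_scaleR: "A *v (r *\<^sub>R x) = r *\<^sub>R (A *v x)" for A :: "complex^'n^'m"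
  by (simp add: vec_eq_iff matrix_vector_mult_def scaleR_conv_of_real[where 'a=complex] sum_distrib_left algebra_simps)

lemma scaleR_matrix_vector_mult: "(r *\<^sub>R A) *v x = r *\<^sub>R (A *v x)" for A :: "complex^'n^'m"
  by (simp add: vec_eq_iff matrix_vector_mult_def scaleR_conv_of_real[where 'a=complex] sum_distrib_left algebra_simps)

lemma sum_matrix_vector_mult: "(\<Sum>i\<in>I. A i) *v x = (\<Sum>i\<in>I. A i *v x)" for x :: "complex^'n"
  by (induction I rule: infinite_finite_induct) (simp_all add: matrix_vector_mult_add_rdistrib)

lemma cinner_ctranspose: "cinner (A *v x) y = cinner x (ctranspose A *v y)"
proof -
  have "cinner (A *v x) y = (\<Sum>i\<in>UNIV. \<Sum>j\<in>UNIV. A $ i $ j * x $ j * cnj (y $ i))"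
    by (simp add: cinner_def matrix_vector_mult_def sum_distrib_right)
  also have "\<dots> = (\<Sum>j\<in>UNIV. \<Sum>i\<in>UNIV. A $ i $ j * x $ j * cnj (y $ i))" by (rule sum.swap)
  also have "\<dots> = cinner x (ctranspose A *v y)"
    by (simp add: cinner_def matrix_vector_mult_def ctranspose_def sum_distrib_left mult_ac)
  finally show ?thesis .
qed

lemma ctranspose_ctranspose [simp]: "ctranspose (ctranspose A) = A"
  by (simp add: ctranspose_def vec_eq_iff)

lemma ctranspose_mult: "ctranspose (A ** B) = ctranspose B ** ctranspose A"
  by (simp add: ctranspose_def matrix_matrix_mult_def vec_eq_iff mult.commute)

lemma ctranspose_add: "ctranspose (A + B) = ctranspose A + ctranspose B"
  by (simp add: ctranspose_def vec_eq_iff)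

lemma ctranspose_scaleR: "ctranspose (r *\<^sub>R A) = r *\<^sub>R ctranspose A"
  by (simp add: ctranspose_def vec_eq_iff)

lemma ctranspose_sum: "ctranspose (\<Sum>i\<in>I. A i) = (\<Sum>i\<in>I. ctranspose (A i))"
  by (induction I rule: infinite_finite_induct) (simp_all add: ctranspose_add, simp_all add: ctranspose_def vec_eq_iff)

lemma ctranspose_tensor: "ctranspose (tensor x y) = tensor y x"
  by (simp add: ctranspose_def tensor_def vec_eq_iff mult.commute)

section \<open>Orthonormal lists\<close>

definition orthonormal :: "(complex^'d) list \<Rightarrow> bool" where
  "orthonormal vs \<longleftrightarrow>
     (\<forall>i<length vs. \<forall>j<length vs. cinner (vs ! i) (vs ! j) = (if i = j then 1 else 0))"

lemma orthonormalD:
  "orthonormal vs \<Longrightarrow> i < length vs \<Longrightarrow> j < length vs \<Longrightarrow>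
    cinner (vs ! i) (vs ! j) = (if i = j then 1 else 0)"
  by (simp add: orthonormal_def)

lemma orthonormal_snoc:
  assumes "orthonormal vs" "cinner x x = 1" "\<And>v. v \<in> set vs \<Longrightarrow> cinner x v = 0"
  shows "orthonormal (vs @ [x])"
proof -
  have "cinner v x = 0" if "v \<in> set vs" for v
    using assms(3)[OF that] cnj_cinner[of x v] by simp
  then show ?thesis
    using assms unfolding orthonormal_def by (auto simp: nth_append less_Suc_eq)
qed

lemma tensor_sum_entry:
  "(\<Sum>i\<in>I. tensor (x i) (y i)) $ a $ b = (\<Sum>i\<in>I. x i $ a * cnj (y i $ b))"
  by (simp add: tensor_def)

text \<open>
  The columns are the vectors of the list; \<open>f\<close> labels them because columns are indexed by the abstract
  type and lists by natural numbers.
\<close>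

definition unitary_of :: "('d \<Rightarrow> nat) \<Rightarrow> (complex^'d) list \<Rightarrow> complex^'d^'d" where
  "unitary_of f v = (\<chi> a j. v ! (f j) $ a)"

lemma unitary_of_unitary:
  fixes v :: "(complex^'d) list"
  assumes "orthonormal v" "length v = CARD('d)" and f: "bij_betw f (UNIV :: 'd set) {..<CARD('d)}"
  shows "ctranspose (unitary_of f v) ** unitary_of f v = mat 1"
    "unitary_of f v ** ctranspose (unitary_of f v) = mat 1"
proof -
  have lt: "f j < length v" for j using f assms(2) by (auto simp: bij_betw_def)
  have inj: "f i = f j \<longleftrightarrow> i = j" for i j using f by (auto simp: bij_betw_def inj_on_def)
  have "(ctranspose (unitary_of f v) ** unitary_of f v) $ i $ j = cinner (v ! f j) (v ! f i)" for i j
    by (simp add: unitary_of_def ctranspose_def matrix_matrix_mult_def cinner_def mult.commute)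
  then show "ctranspose (unitary_of f v) ** unitary_of f v = mat 1"
    using orthonormalD[OF assms(1) lt lt] inj by (auto simp: vec_eq_iff mat_def)
  then show "unitary_of f v ** ctranspose (unitary_of f v) = mat 1"
    by (simp add: matrix_left_right_inverse)
qed

lemma obtains_index_bij:
  obtains f where "bij_betw f (UNIV :: 'd::finite set) {..<CARD('d)}"
  using ex_bij_betw_finite_nat[of "UNIV :: 'd set"] by (auto simp: atLeast0LessThan)

text \<open>
  For a square matrix \<open>U\<close>, \<open>U\<^sup>*U = I\<close> implies \<open>U U\<^sup>* = I\<close>, and the latter is the claim when the columns of
  \<open>U\<close> are the given vectors.
\<close>

lemma resolution_of_identity:
  fixes v :: "(complex^'d) list"
  assumes "orthonormal v" "length v = CARD('d)"
  shows "(\<Sum>i<CARD('d). tensor (v ! i) (v ! i)) = mat 1"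
proof -
  obtain f where f: "bij_betw f (UNIV :: 'd set) {..<CARD('d)}" by (rule obtains_index_bij)
  have "(\<Sum>i<CARD('d). tensor (v ! i) (v ! i)) $ a $ b
      = (unitary_of f v ** ctranspose (unitary_of f v)) $ a $ b" for a b
    unfolding tensor_sum_entry
    using sum.reindex_bij_betw[OF f, of "\<lambda>i. v ! i $ a * cnj (v ! i $ b)"]
    by (simp add: unitary_of_def ctranspose_def matrix_matrix_mult_def)
  then show ?thesis using unitary_of_unitary[OF assms f] by (simp add: vec_eq_iff)
qed

lemma orthonormal_expansion:
  fixes v :: "(complex^'d) list"
  assumes "orthonormal v" "length v = CARD('d)"
  shows "x = (\<Sum>i<CARD('d). cinner x (v ! i) *s v ! i)"
proof -
  have "x = (\<Sum>i<CARD('d). tensor (v ! i) (v ! i)) *v x"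
    using resolution_of_identity[OF assms] by simp
  then show ?thesis by (simp add: sum_matrix_vector_mult tensor_mult_vec)
qed

lemma is_onb_iff_orthonormal:
  fixes v :: "(complex^'d) list"
  shows "is_onb v \<longleftrightarrow> orthonormal v \<and> length v = CARD('d)"
proof
  assume v: "orthonormal v \<and> length v = CARD('d)"
  have "x \<in> vec.span (set v)" for x
  proof -
    have "(\<Sum>i<CARD('d). cinner x (v ! i) *s v ! i) \<in> vec.span (set v)"
      using v by (intro vec.span_sum vec.span_scale vec.span_base) simp
    then show ?thesis using orthonormal_expansion[of v x] v by simp
  qed
  then show "is_onb v" using v by (auto simp: is_onb_def orthonormal_def)
qed (simp add: is_onb_def orthonormal_def)

lemma parseval:
  fixes v :: "(complex^'d) list"
  assumes "orthonormal v" "length v = CARD('d)"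
  shows "(\<Sum>i<CARD('d). (cmod (cinner x (v ! i)))\<^sup>2) = (norm x)\<^sup>2"
proof -
  have "cinner x x = cinner (\<Sum>i<CARD('d). cinner x (v ! i) *s v ! i) x"
    using orthonormal_expansion[OF assms, of x] by simp
  also have "\<dots> = (\<Sum>i<CARD('d). cinner x (v ! i) * cnj (cinner x (v ! i)))"
    by (simp add: cinner_sum_left cinner_simps cnj_cinner)
  also have "\<dots> = of_real (\<Sum>i<CARD('d). (cmod (cinner x (v ! i)))\<^sup>2)"
    by (simp add: complex_norm_square del: of_real_power)
  finally show ?thesis unfolding cinner_self of_real_eq_iff by simp
qed

text \<open>
  Too few vectors do not span; subtract from a vector outside the span its projection onto the span.
\<close>

lemma orthonormal_not_spanning:
  fixes vs :: "(complex^'d) list"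
  assumes "orthonormal vs" "length vs < CARD('d)"
  obtains x where "x \<noteq> 0" "\<And>v. v \<in> set vs \<Longrightarrow> cinner x v = 0"
proof -
  have "vec.span (set vs) \<noteq> UNIV"
  proof
    assume "vec.span (set vs) = UNIV"
    then have "vec.dim (UNIV :: (complex^'d) set) \<le> card (set vs)"
      by (intro vec.dim_le_card) auto
    then show False using assms(2) card_length[of vs] by (simp add: card_cart_basis)
  qed
  then obtain y where y: "y \<notin> vec.span (set vs)" by auto
  define p where "p = (\<Sum>i<length vs. cinner y (vs ! i) *s vs ! i)"
  have "p \<in> vec.span (set vs)" unfolding p_def
    by (intro vec.span_sum vec.span_scale vec.span_base) simp
  with y have "y - p \<noteq> 0" by auto
  moreover have "cinner (y - p) v = 0" if v: "v \<in> set vs" for v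
  proof -
    obtain j where j: "j < length vs" "v = vs ! j" using v by (auto simp: in_set_conv_nth)
    have "cinner p v = (\<Sum>i<length vs. if i = j then cinner y (vs ! i) else 0)"
      unfolding p_def cinner_sum_left j(2) using j(1) orthonormalD[OF assms(1)]
      by (intro sum.cong) (auto simp: cinner_simps)
    then show ?thesis using j by (simp add: cinner_simps)
  qed
  ultimately show ?thesis using that by blast
qed

section \<open>Eigenbases of Hermitian matrices\<close>

lemma continuous_on_cinner [continuous_intros]:
  assumes "continuous_on S f" "continuous_on S g"
  shows "continuous_on S (\<lambda>x. cinner (f x) (g x))"
  unfolding cinner_def by (intro continuous_intros assms)

lemma continuous_on_matrix_vector [continuous_intros]:
  fixes A :: "complex^'n^'m"
  assumes "continuous_on S f"
  shows "continuous_on S (\<lambda>x. A *v f x)"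
  by (rule bounded_linear.continuous_on[OF matrix_vector_mul_bounded_linear assms])

text \<open>
  First-order condition: the form is non-negative along \<open>x + c y\<close> and zero at \<open>c = 0\<close>, so
  its linear term in \<open>c\<close> vanishes. This will turn a maximiser of a quadratic form into an eigenvector.
\<close>

lemma semidefinite_zero_on_subspace:
  assumes herm: "ctranspose B = B"
    and nonneg: "\<And>y. y \<in> W \<Longrightarrow> 0 \<le> Re (cinner (B *v y) y)"
    and W: "\<And>c. x + c *s y \<in> W"
    and x: "Re (cinner (B *v x) x) = 0"
  shows "cinner (B *v x) y = 0"
proof (rule ccontr)
  define b where "b = cinner (B *v x) y"
  define q where "q = Re (cinner (B *v y) y)"
  assume "cinner (B *v x) y \<noteq> 0"
  then have b: "0 < (cmod b)\<^sup>2" by (simp add: b_def)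
  have yx: "cinner (B *v y) x = cnj b"
    using cinner_ctranspose[of B y x] herm by (simp add: b_def cnj_cinner)
  have quad: "0 \<le> r\<^sup>2 * ((cmod b)\<^sup>2 * q) - 2 * r * (cmod b)\<^sup>2" for r
  proof -
    \<comment> \<open>The phase for which the linear term is \<open>- 2 r \<bar>b\<bar>\<^sup>2\<close>, a decrease for \<open>r > 0\<close>.\<close>
    define c where "c = - (of_real r * b)"
    have "cinner (B *v (x + c *s y)) (x + c *s y)
        = cinner (B *v x) x + cnj c * b + c * cnj b + c * cnj c * cinner (B *v y) y"
      by (simp add: matrix_vector_right_distrib vec.scale cinner_simps yx b_def algebra_simps)
    also have "Re \<dots> = Re (cinner (B *v x) x) - 2 * r * (cmod b)\<^sup>2 + r\<^sup>2 * (cmod b)\<^sup>2 * q"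
    proof -
      have "b * cnj b = of_real ((cmod b)\<^sup>2)" by (simp add: complex_norm_square del: of_real_power)
      then have "cnj c * b = of_real (- r * (cmod b)\<^sup>2)" "c * cnj b = of_real (- r * (cmod b)\<^sup>2)"
        "c * cnj c = of_real (r\<^sup>2 * (cmod b)\<^sup>2)"
        by (simp_all add: c_def mult_ac power2_eq_square)
      then show ?thesis unfolding q_def by simp
    qed
    finally show ?thesis using nonneg[OF W[of c]] x by (simp add: algebra_simps)
  qed
  show False
  proof (cases "q \<le> 0")
    case True
    then have "(cmod b)\<^sup>2 * q \<le> 0" using b by (simp add: mult_le_0_iff)
    then show False using quad[of 1] b by simp
  next
    case False
    have "(1/q)\<^sup>2 * ((cmod b)\<^sup>2 * q) = (cmod b)\<^sup>2 / q" using False by (simp add: power2_eq_square)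
    then show False using quad[of "1/q"] b False by (simp add: field_simps)
  qed
qed

text \<open>
  The orthogonal complement \<open>W\<close> of the eigenvectors found so far is invariant under \<open>A\<close>. A maximiser
  \<open>x\<close> of the quadratic form on the unit sphere of \<open>W\<close>, with maximum \<open>l\<close>, is a zero of the form of
  \<open>l I - A\<close>, which is non-negative on \<open>W\<close>; hence \<open>(l I - A) x\<close> is orthogonal to \<open>W\<close>, but it also
  lies in \<open>W\<close>.
\<close>

lemma hermitian_next_eigenvector:
  fixes A :: "complex^'d^'d"
  assumes herm: "ctranspose A = A" and vs: "orthonormal vs" "length vs < CARD('d)"
    and eig: "\<And>v. v \<in> set vs \<Longrightarrow> \<exists>l::real. A *v v = l *\<^sub>R v"
  obtains x and l :: real where "orthonormal (vs @ [x])" "A *v x = l *\<^sub>R x"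
proof -
  define W where "W = {x. \<forall>v\<in>set vs. cinner x v = 0}"
  have W_lin: "x + c *s y \<in> W" if "x \<in> W" "y \<in> W" for x y c
    using that by (simp add: W_def cinner_simps)
  have W_inv: "A *v x \<in> W" if "x \<in> W" for x
    unfolding W_def
  proof (intro CollectI ballI)
    fix v assume v: "v \<in> set vs"
    then obtain l :: real where "A *v v = l *\<^sub>R v" using eig by blast
    then show "cinner (A *v x) v = 0"
      using that v by (simp add: cinner_ctranspose herm cinner_simps W_def)
  qed
  let ?q = "\<lambda>x. Re (cinner (A *v x) x)"
  have "closed W"
  proof -
    have "W = (\<Inter>v\<in>set vs. {x. cinner x v = 0})" by (auto simp: W_def)
    then show ?thesis
      by (auto intro!: closed_INT closed_Collect_eq continuous_intros)
  qed
  then have "compact (W \<inter> sphere 0 1)" by (intro closed_Int_compact) auto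
  moreover obtain z where z: "z \<noteq> 0" "\<And>v. v \<in> set vs \<Longrightarrow> cinner z v = 0"
    by (rule orthonormal_not_spanning[OF vs]) blast
  have "(1 / norm z) *\<^sub>R z \<in> W \<inter> sphere 0 1"
    using z by (simp add: W_def cinner_simps)
  then have "W \<inter> sphere 0 1 \<noteq> {}" by blast
  moreover have "continuous_on (W \<inter> sphere 0 1) ?q" by (intro continuous_intros)
  ultimately have "\<exists>x\<in>W \<inter> sphere 0 1. \<forall>y\<in>W \<inter> sphere 0 1. ?q y \<le> ?q x"
    by (rule continuous_attains_sup)
  then obtain x where "x \<in> W \<inter> sphere 0 1" and max_sphere: "\<forall>y\<in>W \<inter> sphere 0 1. ?q y \<le> ?q x"
    by blast
  then have x: "x \<in> W" "norm x = 1" by simp_all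
  have max: "?q y \<le> ?q x" if "y \<in> W" "norm y = 1" for y
    using max_sphere that by simp
  define l where "l = ?q x"
  have bound: "?q y \<le> l * (norm y)\<^sup>2" if "y \<in> W" for y
  proof (cases "y = 0")
    case False
    let ?u = "(1 / norm y) *\<^sub>R y"
    have "?q ?u \<le> l" unfolding l_def
      using that False by (intro max) (simp_all add: W_def cinner_simps)
    moreover have "?q ?u = ?q y / (norm y)\<^sup>2"
      by (simp add: matrix_vector_mult_scaleR cinner_simps power2_eq_square)
    ultimately show ?thesis using False by (simp add: field_simps)
  qed (simp add: cinner_simps)
  define B where "B = l *\<^sub>R mat 1 + (-1) *\<^sub>R A"
  have Bv: "B *v y = l *\<^sub>R y - A *v y" for y
    by (simp only: B_def matrix_vector_mult_add_rdistrib scaleR_matrix_vector_mult) simp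
  have B_herm: "ctranspose B = B"
  proof -
    have "ctranspose (mat 1 :: complex^'d^'d) = mat 1" by (auto simp: ctranspose_def mat_def vec_eq_iff)
    then show ?thesis unfolding B_def ctranspose_add ctranspose_scaleR herm by simp
  qed
  have Bq: "Re (cinner (B *v y) y) = l * (norm y)\<^sup>2 - ?q y" for y
    by (simp add: Bv cinner_simps cinner_self del: of_real_power)
  have ortho: "cinner (B *v x) y = 0" if "y \<in> W" for y
  proof (rule semidefinite_zero_on_subspace[OF B_herm, of W])
    show "0 \<le> Re (cinner (B *v z) z)" if "z \<in> W" for z
      using bound[OF that] by (simp add: Bq)
    show "Re (cinner (B *v x) x) = 0" using x by (simp add: Bq l_def)
  qed (use x that W_lin in auto)
  have "l *\<^sub>R x + (-1) *s (A *v x) \<in> W"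
    using W_lin[of "l *\<^sub>R x" "A *v x" "-1"] W_inv[OF x(1)] x by (simp add: W_def cinner_simps)
  then have "B *v x \<in> W" by (simp add: Bv)
  from ortho[OF this] have "A *v x = l *\<^sub>R x" by (simp add: cinner_self_eq_0_iff Bv)
  moreover have "orthonormal (vs @ [x])"
    using x by (intro orthonormal_snoc vs) (auto simp: W_def cinner_self)
  ultimately show ?thesis using that by blast
qed

lemma hermitian_eigenbasis:
  fixes A :: "complex^'d^'d"
  assumes herm: "ctranspose A = A"
  obtains v where "orthonormal v" "length v = CARD('d)" "\<And>x. x \<in> set v \<Longrightarrow> \<exists>l::real. A *v x = l *\<^sub>R x"
proof -
  have "\<exists>v. orthonormal v \<and> length v = k \<and> (\<forall>x\<in>set v. \<exists>l::real. A *v x = l *\<^sub>R x)"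
    if "k \<le> CARD('d)" for k
    using that
  proof (induction k)
    case 0
    show ?case by (intro exI[of _ "[]"]) (simp add: orthonormal_def)
  next
    case (Suc k)
    then obtain v where v: "orthonormal v" "length v = k" "\<forall>x\<in>set v. \<exists>l::real. A *v x = l *\<^sub>R x"
      by auto
    from hermitian_next_eigenvector[OF herm v(1)] v(2,3) Suc.prems
    obtain x and l :: real where "orthonormal (v @ [x])" "A *v x = l *\<^sub>R x" by auto
    then show ?case using v by (intro exI[of _ "v @ [x]"]) auto
  qed
  then show ?thesis using that by blast
qed

section \<open>Matrices diagonal in a given orthonormal basis\<close>

text \<open>
  The matrix that is diagonal in the basis \<open>v\<close> with entries \<open>l\<close>. Both decompositions in the
  characterisation of the minimisers have this form.
\<close>

definition spectral_sum :: "(complex^'d) list \<Rightarrow> (nat \<Rightarrow> real) \<Rightarrow> complex^'d^'d" where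
  "spectral_sum v l = (\<Sum>i<CARD('d). l i *\<^sub>R tensor (v ! i) (v ! i))"

lemma spectral_sum_cong:
  fixes v :: "(complex^'d) list"
  assumes "\<And>i. i < CARD('d) \<Longrightarrow> a i = b i"
  shows "spectral_sum v a = spectral_sum v b"
  using assms unfolding spectral_sum_def by (intro sum.cong) auto

lemma ctranspose_spectral_sum: "ctranspose (spectral_sum v l) = spectral_sum v l"
  by (simp add: spectral_sum_def ctranspose_sum ctranspose_scaleR ctranspose_tensor)

lemma spectral_sum_vec:
  "spectral_sum v l *v x = (\<Sum>i<CARD('d). (of_real (l i) * cinner x (v ! i)) *s v ! i)"
  for v :: "(complex^'d) list"
proof -
  have "r *\<^sub>R (c *s y) = (of_real r * c) *s y" for r c and y :: "complex^'d"
    by (simp add: vec_eq_iff scaleR_conv_of_real[where 'a=complex] mult_ac)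
  then show ?thesis
    by (simp add: spectral_sum_def sum_matrix_vector_mult scaleR_matrix_vector_mult tensor_mult_vec)
qed

text \<open>
  Characteristic polynomials are handled through their values, so that only determinants of complex
  matrices have to be computed.
\<close>

lemma poly_charpoly: "poly (charpoly A) z = det (mat z - A)" for A :: "complex^'n^'n"
proof -
  let ?M = "\<chi> i j. (if i = j then [:0, 1:] else 0) - [:A $ i $ j:] :: complex poly^'n^'n"
  have "poly (?M $ i $ j) z = (mat z - A) $ i $ j" for i j
    by (simp add: mat_def)
  then show ?thesis
    unfolding charpoly_def det_def poly_sum poly_mult poly_prod
    by (simp add: of_int_poly poly_of_int)
qed

context
  fixes v :: "(complex^'d) list"
  assumes v: "orthonormal v" "length v = CARD('d)"
begin

lemma spectral_sum_basis:
  assumes j: "j < CARD('d)"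
  shows "spectral_sum v l *v (v ! j) = l j *\<^sub>R v ! j"
proof -
  have "spectral_sum v l *v (v ! j) = (\<Sum>i<CARD('d). if i = j then of_real (l j) *s v ! j else 0)"
    unfolding spectral_sum_vec using j orthonormalD[OF v(1)] v(2)
    by (intro sum.cong) (auto simp: vec_eq_iff)
  then show ?thesis using j by (simp add: vec_eq_iff scaleR_conv_of_real[where 'a=complex])
qed

lemma matrix_eq_on_basis:
  assumes "\<And>j. j < CARD('d) \<Longrightarrow> A *v (v ! j) = B *v (v ! j)"
  shows "A = B"
proof -
  have "A *v x = B *v x" for x
    by (subst (1 2) orthonormal_expansion[OF v, of x]) (simp add: vec.sum vec.scale assms)
  then show ?thesis by (simp add: matrix_eq)
qed

lemma eigenbasis_spectral_sum:
  assumes "\<And>j. j < CARD('d) \<Longrightarrow> A *v (v ! j) = l j *\<^sub>R v ! j"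
  shows "A = spectral_sum v l"
  by (rule matrix_eq_on_basis) (simp add: assms spectral_sum_basis)

lemma spectral_sum_mult: "spectral_sum v l ** spectral_sum v m = spectral_sum v (\<lambda>i. l i * m i)"
  by (rule matrix_eq_on_basis)
    (simp add: spectral_sum_basis matrix_vector_mult_scaleR flip: matrix_vector_mul_assoc)

lemma spectral_sum_one: "spectral_sum v (\<lambda>_. 1) = mat 1"
  by (rule matrix_eq_on_basis) (simp add: spectral_sum_basis)

lemma spectral_sum_invertible:
  assumes "\<And>i. i < CARD('d) \<Longrightarrow> l i \<noteq> 0"
  shows "invertible (spectral_sum v l)"
proof -
  have "spectral_sum v l ** spectral_sum v (\<lambda>i. 1 / l i) = mat 1"
    unfolding spectral_sum_mult spectral_sum_one[symmetric] using assms
    by (intro matrix_eq_on_basis) (simp add: spectral_sum_basis)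
  then show ?thesis using invertible_right_inverse by blast
qed

lemma spectral_sum_form:
  "Re (cinner (spectral_sum v l *v x) x) = (\<Sum>i<CARD('d). l i * (cmod (cinner x (v ! i)))\<^sup>2)"
proof -
  have "cinner (spectral_sum v l *v x) x
      = (\<Sum>i<CARD('d). of_real (l i) * (cinner x (v ! i) * cnj (cinner x (v ! i))))"
    by (simp add: spectral_sum_vec cinner_sum_left cinner_simps cnj_cinner mult_ac)
  also have "\<dots> = of_real (\<Sum>i<CARD('d). l i * (cmod (cinner x (v ! i)))\<^sup>2)"
    by (simp add: complex_norm_square del: of_real_power)
  finally show ?thesis by (simp del: of_real_sum)
qed

lemma spectral_sum_norm:
  "(norm (spectral_sum v l *v x))\<^sup>2 = (\<Sum>i<CARD('d). (l i)\<^sup>2 * (cmod (cinner x (v ! i)))\<^sup>2)"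
proof -
  have "(norm (spectral_sum v l *v x))\<^sup>2 = Re (cinner (spectral_sum v l *v x) (spectral_sum v l *v x))"
    by (simp add: cinner_self del: of_real_power)
  also have "\<dots> = Re (cinner ((spectral_sum v l ** spectral_sum v l) *v x) x)"
    by (metis cinner_ctranspose ctranspose_spectral_sum matrix_vector_mul_assoc)
  finally show ?thesis unfolding spectral_sum_mult spectral_sum_form by (simp add: power2_eq_square)
qed

lemma spectral_norm_spectral_sum_le:
  assumes "\<And>i. i < CARD('d) \<Longrightarrow> \<bar>l i\<bar> \<le> K" and K: "0 \<le> K"
  shows "spectral_norm (spectral_sum v l) \<le> K"
  unfolding spectral_norm_def
proof (rule onorm_le)
  fix x
  have "(norm (spectral_sum v l *v x))\<^sup>2 \<le> (\<Sum>i<CARD('d). K\<^sup>2 * (cmod (cinner x (v ! i)))\<^sup>2)"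
    unfolding spectral_sum_norm using assms by (intro sum_mono mult_right_mono) (auto simp: abs_le_square_iff[symmetric])
  also have "\<dots> = (K * norm x)\<^sup>2"
    using parseval[OF v, of x] by (simp add: sum_distrib_left[symmetric] power_mult_distrib)
  finally show "norm (spectral_sum v l *v x) \<le> K * norm x"
    by (rule power2_le_imp_le) (simp add: K)
qed

lemma spectral_sum_unitary_diagonal:
  assumes f: "bij_betw f (UNIV :: 'd set) {..<CARD('d)}"
  shows "mat z - spectral_sum v l
    = unitary_of f v ** (\<chi> i j. if i = j then z - of_real (l (f i)) else 0) ** ctranspose (unitary_of f v)"
    (is "_ = ?U ** ?D ** _")
proof -
  have "(mat z - spectral_sum v l) $ a $ b = (?U ** ?D ** ctranspose ?U) $ a $ b" for a b
  proof -
    have "(mat z :: complex^'d^'d) $ a $ b = z * (mat 1 :: complex^'d^'d) $ a $ b"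
      by (simp add: mat_def)
    also have "\<dots> = (\<Sum>i<CARD('d). z * (v ! i $ a * cnj (v ! i $ b)))"
      unfolding resolution_of_identity[OF v, symmetric] tensor_sum_entry by (simp add: sum_distrib_left)
    moreover have "spectral_sum v l $ a $ b = (\<Sum>i<CARD('d). of_real (l i) * (v ! i $ a * cnj (v ! i $ b)))"
      by (simp add: spectral_sum_def tensor_def scaleR_conv_of_real[where 'a=complex])
    ultimately have "(mat z - spectral_sum v l) $ a $ b
        = (\<Sum>i<CARD('d). (z - of_real (l i)) * (v ! i $ a * cnj (v ! i $ b)))"
      by (simp add: sum_subtractf algebra_simps)
    also have "\<dots> = (\<Sum>j\<in>UNIV. (z - of_real (l (f j))) * (v ! f j $ a * cnj (v ! f j $ b)))"
      by (rule sum.reindex_bij_betw[OF f, symmetric])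
    also have "\<dots> = (?U ** ?D ** ctranspose ?U) $ a $ b"
      by (simp add: matrix_matrix_mult_def unitary_of_def ctranspose_def if_distrib if_distribR
          sum.delta' mult_ac cong: if_cong)
    finally show ?thesis .
  qed
  then show ?thesis by (simp add: vec_eq_iff)
qed

lemma det_shifted_spectral_sum: "det (mat z - spectral_sum v l) = (\<Prod>i<CARD('d). z - of_real (l i))"
proof -
  obtain f where f: "bij_betw f (UNIV :: 'd set) {..<CARD('d)}" by (rule obtains_index_bij)
  let ?U = "unitary_of f v"
  let ?D = "(\<chi> i j. if i = j then z - of_real (l (f i)) else 0) :: complex^'d^'d"
  have "det (mat z - spectral_sum v l) = det ?U * det (ctranspose ?U) * det ?D"
    unfolding spectral_sum_unitary_diagonal[OF f] det_mul by simp
  also have "det ?U * det (ctranspose ?U) = det (?U ** ctranspose ?U)" by (simp add: det_mul)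
  also have "\<dots> = 1" using unitary_of_unitary[OF v f] by simp
  also have "det ?D = (\<Prod>i\<in>UNIV. z - of_real (l (f i)))"
    by (subst det_diagonal) auto
  also have "\<dots> = (\<Prod>i<CARD('d). z - of_real (l i))"
    by (rule prod.reindex_bij_betw[OF f])
  finally show ?thesis by simp
qed

lemma det_spectral_sum: "det (spectral_sum v l) = of_real (\<Prod>i<CARD('d). l i)"
proof -
  have "mat 0 - spectral_sum v (\<lambda>i. - l i) = spectral_sum v l"
    by (simp add: spectral_sum_def mat_def vec_eq_iff sum_negf)
  then show ?thesis using det_shifted_spectral_sum[of 0 "\<lambda>i. - l i"] by simp
qed

lemma charpoly_spectral_sum: "charpoly (spectral_sum v l) = (\<Prod>i<CARD('d). [:- of_real (l i), 1:])"
  by (rule poly_ext) (simp add: poly_charpoly det_shifted_spectral_sum poly_prod)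

lemma eigvals_spectral_sum: "eigvals (spectral_sum v l) = decr (map l [0..<CARD('d)])"
proof -
  have "proots (charpoly (spectral_sum v l)) = (\<Sum>i<CARD('d). {#of_real (l i)#})"
    unfolding charpoly_spectral_sum by (subst proots_prod) auto
  also have "image_mset Re \<dots> = mset (map l [0..<CARD('d)])"
  proof -
    have "image_mset Re (\<Sum>i<n. {#complex_of_real (l i)#}) = mset (map l [0..<n])" for n
      by (induction n) (auto simp: lessThan_Suc)
    then show ?thesis .
  qed
  finally show ?thesis unfolding eigvals_def decr_def by (simp flip: sorted_list_of_multiset_mset)
qed

end

lemma sorted_wrt_eigvals: "sorted_wrt (\<ge>) (eigvals S)"
proof -
  have "sorted (rev (eigvals S))" by (simp add: eigvals_def)
  then show ?thesis by (simp add: sorted_wrt_rev)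
qed

lemma charpoly_similar:
  fixes A B P :: "complex^'d^'d"
  assumes P: "invertible P" and similar: "P ** A = B ** P"
  shows "charpoly A = charpoly B"
proof (rule poly_ext)
  fix z
  have scalar: "P ** mat z = mat z ** P"
    by (simp add: matrix_matrix_mult_def mat_def vec_eq_iff if_distrib if_distribR sum.delta sum.delta' mult.commute cong: if_cong)
  have diff: "C ** (D - E) = C ** D - C ** E" "(D - E) ** C = D ** C - E ** C" for C D E :: "complex^'d^'d"
    by (simp_all add: matrix_matrix_mult_def vec_eq_iff algebra_simps sum_subtractf)
  have "P ** (mat z - A) = (mat z - B) ** P"
    using scalar similar by (simp add: diff)
  then have "det P * det (mat z - A) = det (mat z - B) * det P" by (metis det_mul)
  then show "poly (charpoly A) z = poly (charpoly B) z"
    using P by (simp add: poly_charpoly invertible_det_nz)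
qed

text \<open>
  \<open>A\<close> conjugates \<open>B A\<close> into \<open>A B\<close>.
\<close>

lemma eigvals_mult_commute:
  fixes A B :: "complex^'d^'d"
  assumes "invertible A"
  shows "eigvals (A ** B) = eigvals (B ** A)"
proof -
  have "charpoly (B ** A) = charpoly (A ** B)"
    using assms by (rule charpoly_similar) (simp add: matrix_mul_assoc)
  then show ?thesis by (simp add: eigvals_def)
qed

text \<open>
  The definition of \<open>eigvals\<close> fixes a non-increasing order, so the eigenbasis is sorted by
  eigenvalue in order to match it index by index.
\<close>

lemma hermitian_spectral_sum:
  fixes A :: "complex^'d^'d"
  assumes herm: "ctranspose A = A"
  obtains v where "orthonormal v" "length v = CARD('d)" "A = spectral_sum v ((!) (eigvals A))"
proof -
  obtain v where v: "orthonormal v" "length v = CARD('d)"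
    and eig: "\<And>x. x \<in> set v \<Longrightarrow> \<exists>l::real. A *v x = l *\<^sub>R x"
    using hermitian_eigenbasis[OF herm] by blast
  then obtain k where k: "\<And>x. x \<in> set v \<Longrightarrow> A *v x = k x *\<^sub>R x" by metis
  define w where "w = rev (sort_key k v)"
  have mset: "mset w = mset v" by (simp add: w_def)
  then have w_len: "length w = CARD('d)" using v(2) by (metis size_mset)
  obtain p where p: "p permutes {..<length v}" "permute_list p v = w"
    using mset_eq_permutation[OF mset] by blast
  have w_nth: "w ! i = v ! p i" and p_lt: "p i < length v" if "i < CARD('d)" for i
    using p that v(2) permute_list_nth[OF p(1)] permutes_in_image[OF p(1)] by auto
  have w: "orthonormal w"
    unfolding orthonormal_def w_len
  proof (intro allI impI)
    fix i j assume ij: "i < CARD('d)" "j < CARD('d)"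
    have "p i = p j \<longleftrightarrow> i = j" using permutes_inj[OF p(1)] by (auto simp: inj_def)
    then show "cinner (w ! i) (w ! j) = (if i = j then 1 else 0)"
      using orthonormalD[OF v(1) p_lt[OF ij(1)] p_lt[OF ij(2)]] w_nth ij by simp
  qed
  have "A *v (w ! j) = k (w ! j) *\<^sub>R w ! j" if "j < CARD('d)" for j
    using that w_len mset by (intro k) (metis nth_mem set_mset_mset)
  then have A: "A = spectral_sum w (\<lambda>i. k (w ! i))"
    by (rule eigenbasis_spectral_sum[OF w w_len])
  then have "eigvals A = decr (map (\<lambda>i. k (w ! i)) [0..<CARD('d)])"
    by (metis eigvals_spectral_sum[OF w w_len])
  also have "map (\<lambda>i. k (w ! i)) [0..<CARD('d)] = map k w"
    using w_len by (intro nth_equalityI) auto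
  also have "decr (map k w) = map k w"
  proof -
    have "sort (map k w) = map k (sort_key k v)"
      by (rule properties_for_sort) (auto simp: w_def)
    then show ?thesis by (simp add: decr_def w_def rev_map)
  qed
  finally have "eigvals A ! i = k (w ! i)" if "i < CARD('d)" for i using that w_len by simp
  then have "spectral_sum w (\<lambda>i. k (w ! i)) = spectral_sum w ((!) (eigvals A))"
    unfolding spectral_sum_def by (intro sum.cong) auto
  then show ?thesis using that[OF w w_len] A by metis
qed

section \<open>Diagonal entries versus eigenvalues\<close>

lemma cmod_cinner_commute: "cmod (cinner x y) = cmod (cinner y x)"
  by (metis cnj_cinner complex_mod_cnj)

lemma norm_orthonormal: "orthonormal v \<Longrightarrow> i < length v \<Longrightarrow> norm (v ! i) = 1"
  using orthonormalD[of v i i] cinner_self[of "v ! i"]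
  by (simp add: abs_square_eq_1 flip: of_real_power)

context
  fixes u v :: "(complex^'d) list" and m :: "nat \<Rightarrow> real" and diag :: "nat \<Rightarrow> real"
  assumes u: "orthonormal u" "length u = CARD('d)"
    and v: "orthonormal v" "length v = CARD('d)"
    and diag: "\<And>i. i < CARD('d) \<Longrightarrow> diag i = Re (cinner (spectral_sum u m *v (v ! i)) (v ! i))"
begin

text \<open>
  The squared moduli \<open>\<bar>\<langle>v\<^sub>i, u\<^sub>j\<rangle>\<bar>\<^sup>2\<close> form a doubly stochastic matrix, and the diagonal is its
  average of the eigenvalues \<open>m\<close>. The gap between the two sums is the weighted sum of the remainders of
  \<open>g\<close> over affine functions with slopes \<open>k\<close>; the slopes are arbitrary because each linear term averages to
  zero. With tangents of a convex \<open>g\<close> every remainder is non-negative: this is the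
  Schur-Jensen inequality together with its equality case.
\<close>

lemma sum_eigvals_minus_sum_diag:
  fixes g :: "real \<Rightarrow> real" and k :: "nat \<Rightarrow> real"
  shows "(\<Sum>j<CARD('d). g (m j)) - (\<Sum>i<CARD('d). g (diag i))
    = (\<Sum>i<CARD('d). \<Sum>j<CARD('d). (cmod (cinner (v ! i) (u ! j)))\<^sup>2
          * (g (m j) - (g (diag i) + k i * (m j - diag i))))"
proof -
  let ?n = "CARD('d)" and ?w = "\<lambda>i j. (cmod (cinner (v ! i) (u ! j)))\<^sup>2"
  have rows: "(\<Sum>j<?n. ?w i j) = 1" if "i < ?n" for i
    using parseval[OF u, of "v ! i"] norm_orthonormal[OF v(1)] v(2) that by simp
  have cols: "(\<Sum>i<?n. ?w i j) = 1" if "j < ?n" for j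
    using parseval[OF v, of "u ! j"] norm_orthonormal[OF u(1)] u(2) that
    by (simp add: cmod_cinner_commute)
  have mean: "(\<Sum>j<?n. ?w i j * m j) = diag i" if "i < ?n" for i
    using diag[OF that] by (simp add: spectral_sum_form[OF u] mult.commute)
  have "(\<Sum>j<?n. ?w i j * (g (m j) - (g (diag i) + k i * (m j - diag i))))
      = (\<Sum>j<?n. ?w i j * g (m j)) - g (diag i)" if i: "i < ?n" for i
  proof -
    have "(\<Sum>j<?n. ?w i j * (g (m j) - (g (diag i) + k i * (m j - diag i))))
      = (\<Sum>j<?n. ?w i j * g (m j)) - (g (diag i) - k i * diag i) * (\<Sum>j<?n. ?w i j)
        - k i * (\<Sum>j<?n. ?w i j * m j)"
      by (simp add: sum_distrib_left sum_subtractf sum.distrib algebra_simps)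
    then show ?thesis by (simp add: rows[OF i] mean[OF i])
  qed
  moreover have "(\<Sum>i<?n. \<Sum>j<?n. ?w i j * g (m j)) = (\<Sum>j<?n. g (m j))"
  proof -
    have "(\<Sum>i<?n. \<Sum>j<?n. ?w i j * g (m j)) = (\<Sum>j<?n. (\<Sum>i<?n. ?w i j) * g (m j))"
      by (subst sum.swap) (simp add: sum_distrib_right)
    then show ?thesis by (simp add: cols)
  qed
  ultimately show ?thesis by (simp add: sum_subtractf)
qed

lemma sum_diag_le_sum_eigvals:
  assumes "\<And>i j. i < CARD('d) \<Longrightarrow> j < CARD('d) \<Longrightarrow> g (diag i) + k i * (m j - diag i) \<le> g (m j)"
  shows "(\<Sum>i<CARD('d). g (diag i)) \<le> (\<Sum>j<CARD('d). g (m j))"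
proof -
  have "0 \<le> (\<Sum>j<CARD('d). g (m j)) - (\<Sum>i<CARD('d). g (diag i))"
    unfolding sum_eigvals_minus_sum_diag[of g k] using assms
    by (intro sum_nonneg mult_nonneg_nonneg) auto
  then show ?thesis by simp
qed

text \<open>
  A vanishing gap forces every weighted remainder to vanish, so \<open>v\<^sub>i\<close> is orthogonal to all eigenvectors
  \<open>u\<^sub>j\<close> with \<open>m\<^sub>j \<noteq> d\<^sub>i\<close>; it is then an eigenvector for \<open>d\<^sub>i\<close>.
\<close>

lemma diagonal_if_sum_eq:
  assumes strict: "\<And>i j. i < CARD('d) \<Longrightarrow> j < CARD('d) \<Longrightarrow> m j \<noteq> diag i \<Longrightarrow>
      g (diag i) + k i * (m j - diag i) < g (m j)"
    and eq: "(\<Sum>j<CARD('d). g (m j)) = (\<Sum>i<CARD('d). g (diag i))"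
  shows "spectral_sum u m = spectral_sum v diag"
proof (rule eigenbasis_spectral_sum[OF v])
  fix i assume i: "i < CARD('d)"
  let ?t = "\<lambda>i j. (cmod (cinner (v ! i) (u ! j)))\<^sup>2 * (g (m j) - (g (diag i) + k i * (m j - diag i)))"
  have nonneg: "0 \<le> ?t i j" if "i < CARD('d)" "j < CARD('d)" for i j
    using strict[OF that] by (cases "m j = diag i") auto
  have "(\<Sum>i<CARD('d). \<Sum>j<CARD('d). ?t i j) = 0"
    using sum_eigvals_minus_sum_diag[of g k] eq by simp
  then have "(\<Sum>j<CARD('d). ?t i j) = 0"
    using i nonneg by (subst (asm) sum_nonneg_eq_0_iff) (auto intro: sum_nonneg)
  then have zero: "?t i j = 0" if "j < CARD('d)" for j
    using i that nonneg by (subst (asm) sum_nonneg_eq_0_iff) auto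
  have "spectral_sum u m *v (v ! i) = (\<Sum>j<CARD('d). (of_real (diag i) * cinner (v ! i) (u ! j)) *s u ! j)"
    unfolding spectral_sum_vec
  proof (intro sum.cong refl)
    fix j assume "j \<in> {..<CARD('d)}"
    then have "cinner (v ! i) (u ! j) = 0 \<or> m j = diag i"
      using zero[of j] strict[OF i, of j] by auto
    then show "(of_real (m j) * cinner (v ! i) (u ! j)) *s u ! j
        = (of_real (diag i) * cinner (v ! i) (u ! j)) *s u ! j" by auto
  qed
  also have "\<dots> = spectral_sum u (\<lambda>_. diag i) *v (v ! i)" by (simp add: spectral_sum_vec)
  also have "spectral_sum u (\<lambda>_. diag i) = diag i *\<^sub>R spectral_sum u (\<lambda>_. 1)"
    by (simp add: spectral_sum_def scaleR_sum_right)
  finally show "spectral_sum u m *v (v ! i) = diag i *\<^sub>R v ! i"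
    by (simp add: spectral_sum_one[OF u] scaleR_matrix_vector_mult)
qed

end

section \<open>Frame operators and near-isometries\<close>

lemma ctranspose_frame_op: "ctranspose (frame_op F) = frame_op F"
  by (induction F) (simp_all add: frame_op_def ctranspose_add ctranspose_tensor, simp add: ctranspose_def vec_eq_iff)

lemma frame_op_form: "Re (cinner (frame_op F *v x) x) = (\<Sum>f\<leftarrow>F. (cmod (cinner x f))\<^sup>2)"
proof (induction F)
  case (Cons f F)
  have "cinner (tensor f f *v x) x = of_real ((cmod (cinner x f))\<^sup>2)"
    by (simp add: tensor_mult_vec cinner_simps complex_norm_square cnj_cinner del: of_real_power)
  with Cons show ?case
    by (simp add: frame_op_def matrix_vector_mult_add_rdistrib cinner_simps)
qed (simp add: frame_op_def cinner_simps)

lemma frame_op_positive: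
  assumes F: "is_frame F" and x: "x \<noteq> 0"
  shows "0 < Re (cinner (frame_op F *v x) x)"
proof (rule ccontr)
  assume "\<not> ?thesis"
  then have "(\<Sum>f\<leftarrow>F. (cmod (cinner x f))\<^sup>2) \<le> 0" by (simp add: frame_op_form)
  moreover have "(cmod (cinner x f))\<^sup>2 \<le> (\<Sum>f\<leftarrow>F. (cmod (cinner x f))\<^sup>2)" if "f \<in> set F" for f
    using that by (intro member_le_sum_list) auto
  ultimately have "(cmod (cinner x f))\<^sup>2 \<le> 0" if "f \<in> set F" for f
    using that order_trans by blast
  then have zero: "cinner x f = 0" if "f \<in> set F" for f using that by simp
  have "vec.subspace {y. cinner x y = 0}"
    by (rule vec.subspaceI) (simp_all add: cinner_simps)
  then have "vec.span (set F) \<subseteq> {y. cinner x y = 0}"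
    using zero by (intro vec.span_minimal) auto
  then have "cinner x x = 0" using F unfolding is_frame_def by blast
  then show False using x by (simp add: cinner_self_eq_0_iff)
qed

text \<open>
  Membership of \<open>V \<cdot> F\<close> in the set of perturbations only provides some admissible matrix with the same
  action on \<open>F\<close>; because \<open>F\<close> spans, this matrix is \<open>V\<close> itself.
\<close>

lemma act_inj:
  assumes F: "is_frame F" and eq: "act V F = act W F"
  shows "V = W"
proof -
  have "vec.subspace {x. V *v x = W *v x}"
    by (rule vec.subspaceI) (simp_all add: matrix_vector_right_distrib vec.scale)
  moreover have "set F \<subseteq> {x. V *v x = W *v x}"
    using eq by (auto simp: act_def)
  ultimately have "vec.span (set F) \<subseteq> {x. V *v x = W *v x}" by (rule vec.span_minimal[rotated])
  then show ?thesis using F by (auto simp: is_frame_def matrix_eq)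
qed

lemma spectral_norm_form_bounds:
  fixes A :: "complex^'d^'d"
  assumes "spectral_norm (A - mat 1) \<le> \<delta>"
  shows "(1 - \<delta>) * (norm x)\<^sup>2 \<le> Re (cinner (A *v x) x)"
    and "Re (cinner (A *v x) x) \<le> (1 + \<delta>) * (norm x)\<^sup>2"
proof -
  have "norm ((A - mat 1) *v x) \<le> spectral_norm (A - mat 1) * norm x"
    unfolding spectral_norm_def by (rule onorm) simp
  also have "\<dots> \<le> \<delta> * norm x" using assms by (intro mult_right_mono) auto
  finally have le: "norm ((A - mat 1) *v x) \<le> \<delta> * norm x" .
  have "\<bar>Re (cinner ((A - mat 1) *v x) x)\<bar> \<le> cmod (cinner ((A - mat 1) *v x) x)"
    by (rule abs_Re_le_cmod)
  also have "\<dots> \<le> norm ((A - mat 1) *v x) * norm x" by (rule norm_cinner_le)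
  also have "\<dots> \<le> \<delta> * norm x * norm x" using le by (intro mult_right_mono) auto
  also have "\<dots> = \<delta> * (norm x)\<^sup>2" by (simp add: power2_eq_square)
  finally have "\<bar>Re (cinner ((A - mat 1) *v x) x)\<bar> \<le> \<delta> * (norm x)\<^sup>2" .
  moreover have "Re (cinner ((A - mat 1) *v x) x) = Re (cinner (A *v x) x) - (norm x)\<^sup>2"
    by (simp add: matrix_vector_mult_diff_rdistrib cinner_simps cinner_self del: of_real_power)
  ultimately show "(1 - \<delta>) * (norm x)\<^sup>2 \<le> Re (cinner (A *v x) x)"
    "Re (cinner (A *v x) x) \<le> (1 + \<delta>) * (norm x)\<^sup>2"
    by (auto simp: algebra_simps)
qed

section \<open>The perturbed spectrum\<close>

locale positive_spectrum =
  fixes v :: "(complex^'d) list" and l :: "nat \<Rightarrow> real"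
  assumes v: "orthonormal v" "length v = CARD('d)"
    and l: "\<And>i. i < CARD('d) \<Longrightarrow> 0 < l i"
begin

definition sqrt_op :: "complex^'d^'d" where
  "sqrt_op = spectral_sum v (\<lambda>i. sqrt (l i))"

text \<open>
  For \<open>S = spectral_sum v l\<close> this is \<open>S\<^sup>1\<^sup>/\<^sup>2 A S\<^sup>1\<^sup>/\<^sup>2\<close>. It is Hermitian whenever \<open>A\<close> is and shows the spectrum of
  the perturbed frame operator as a function of \<open>A = V\<^sup>*V\<close> alone.
\<close>

definition conj_by_sqrt :: "complex^'d^'d \<Rightarrow> complex^'d^'d" where
  "conj_by_sqrt A = sqrt_op ** A ** sqrt_op"

lemma ctranspose_sqrt_op: "ctranspose sqrt_op = sqrt_op"
  by (simp add: sqrt_op_def ctranspose_spectral_sum)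

lemma sqrt_op_mult_sqrt_op: "sqrt_op ** sqrt_op = spectral_sum v l"
  unfolding sqrt_op_def spectral_sum_mult[OF v] using l by (intro spectral_sum_cong) (simp add: less_imp_le)

lemma invertible_sqrt_op: "invertible sqrt_op"
  unfolding sqrt_op_def using l by (intro spectral_sum_invertible[OF v]) (auto simp: less_imp_neq[symmetric])

lemma conj_by_sqrt_form:
  "cinner (conj_by_sqrt A *v x) x = cinner (A *v (sqrt_op *v x)) (sqrt_op *v x)"
  unfolding conj_by_sqrt_def matrix_vector_mul_assoc[symmetric]
  by (simp only: cinner_ctranspose ctranspose_sqrt_op)

lemma norm_sqrt_op_basis: "i < CARD('d) \<Longrightarrow> (norm (sqrt_op *v (v ! i)))\<^sup>2 = l i"
  using l norm_orthonormal[OF v(1)] v(2)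
  by (simp add: sqrt_op_def spectral_sum_basis[OF v] power_mult_distrib less_imp_le)

text \<open>
  With \<open>R = S\<^sup>1\<^sup>/\<^sup>2\<close>, the two matrices are \<open>B B\<^sup>*\<close> and \<open>B\<^sup>*B\<close> for the invertible \<open>B = V R\<close>.
\<close>

lemma eigvals_perturbed:
  fixes V :: "complex^'d^'d"
  assumes "invertible V"
  shows "eigvals (V ** spectral_sum v l ** ctranspose V) = eigvals (conj_by_sqrt (ctranspose V ** V))"
proof -
  have "eigvals ((V ** sqrt_op) ** (sqrt_op ** ctranspose V)) = eigvals ((sqrt_op ** ctranspose V) ** (V ** sqrt_op))"
    using assms invertible_sqrt_op by (intro eigvals_mult_commute invertible_mult)
  then show ?thesis
    by (simp add: conj_by_sqrt_def matrix_mul_assoc flip: sqrt_op_mult_sqrt_op)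
qed

lemma conj_by_sqrt_eq_iff:
  "conj_by_sqrt A = spectral_sum v m \<longleftrightarrow> A = spectral_sum v (\<lambda>i. m i / l i)"
proof
  assume A: "conj_by_sqrt A = spectral_sum v m"
  let ?inv = "spectral_sum v (\<lambda>i. 1 / sqrt (l i))"
  have one: "?inv ** sqrt_op = mat 1" "sqrt_op ** ?inv = mat 1"
    unfolding sqrt_op_def spectral_sum_mult[OF v] spectral_sum_one[OF v, symmetric]
    using l by (auto intro!: spectral_sum_cong simp: less_imp_neq[symmetric])
  have "A = (?inv ** sqrt_op) ** A ** (sqrt_op ** ?inv)" by (simp add: one)
  also have "\<dots> = ?inv ** conj_by_sqrt A ** ?inv"
    by (simp add: conj_by_sqrt_def matrix_mul_assoc)
  also have "\<dots> = spectral_sum v (\<lambda>i. m i / l i)"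
    unfolding A spectral_sum_mult[OF v] using l by (intro spectral_sum_cong) (simp add: less_imp_le)
  finally show "A = spectral_sum v (\<lambda>i. m i / l i)" .
next
  assume A: "A = spectral_sum v (\<lambda>i. m i / l i)"
  have "sqrt (l i) * (m i / l i) * sqrt (l i) = m i" if "i < CARD('d)" for i
    using l[OF that] by (simp add: field_simps)
  then show "conj_by_sqrt A = spectral_sum v m"
    unfolding A conj_by_sqrt_def sqrt_op_def spectral_sum_mult[OF v] by (rule spectral_sum_cong)
qed

lemma det_conj_by_sqrt: "det (conj_by_sqrt A) = det A * of_real (\<Prod>i<CARD('d). l i)"
proof -
  have "det (conj_by_sqrt A) = det A * det (sqrt_op ** sqrt_op)" by (simp add: conj_by_sqrt_def det_mul)
  then show ?thesis by (simp add: sqrt_op_mult_sqrt_op det_spectral_sum[OF v])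
qed

text \<open>
  The diagonal of \<open>T\<close> in the eigenbasis of \<open>S\<close> meets the constraints defining \<open>\<mu>\<close>: the box because
  \<open>d\<^sub>i = \<lambda>\<^sub>i \<langle>A v\<^sub>i, v\<^sub>i\<rangle>\<close>, and the bound on the logarithms by Hadamard's inequality from
  \<open>det T = det A det S\<close>. At the same time it bounds \<open>tr h(T)\<close> from below.
\<close>

lemma conj_by_sqrt_diag_facts:
  fixes V :: "complex^'d^'d" and diag :: "nat \<Rightarrow> real"
  defines "T \<equiv> conj_by_sqrt (ctranspose V ** V)"
  assumes diag_def: "\<And>i. diag i = Re (cinner (T *v (v ! i)) (v ! i))"
    and \<delta>: "0 < \<delta>" "\<delta> < 1" and s: "0 < s"
    and near: "spectral_norm (ctranspose V ** V - mat 1) \<le> \<delta>"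
    and det: "s \<le> Re (det (ctranspose V ** V))"
  shows "i < CARD('d) \<Longrightarrow> (1 - \<delta>) * l i \<le> diag i \<and> diag i \<le> (1 + \<delta>) * l i"
    and "ln s + (\<Sum>i<CARD('d). ln (l i)) \<le> (\<Sum>i<CARD('d). ln (diag i))"
    and "convex_on {0..} h \<Longrightarrow> (\<Sum>i<CARD('d). h (diag i)) \<le> (\<Sum>x\<leftarrow>eigvals T. h x)"
    and "\<lbrakk>convex_on {0..} h; strictly_convex_on {0..} h;
          (\<Sum>x\<leftarrow>eigvals T. h x) = (\<Sum>i<CARD('d). h (diag i))\<rbrakk> \<Longrightarrow> T = spectral_sum v diag"
proof -
  have bounds: "(1 - \<delta>) * l i \<le> diag i \<and> diag i \<le> (1 + \<delta>) * l i" if i: "i < CARD('d)" for i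
    using spectral_norm_form_bounds[OF near, of "sqrt_op *v (v ! i)"]
    unfolding diag_def T_def conj_by_sqrt_form norm_sqrt_op_basis[OF i] by blast
  then show "i < CARD('d) \<Longrightarrow> (1 - \<delta>) * l i \<le> diag i \<and> diag i \<le> (1 + \<delta>) * l i" .
  have diag_pos: "0 < diag i" if "i < CARD('d)" for i
  proof -
    have "0 < (1 - \<delta>) * l i" using l[OF that] \<delta> by simp
    then show ?thesis using bounds[OF that] by linarith
  qed
  have "ctranspose T = T"
    by (simp add: T_def conj_by_sqrt_def ctranspose_mult ctranspose_sqrt_op matrix_mul_assoc)
  then obtain u where u: "orthonormal u" "length u = CARD('d)" and T_eig: "T = spectral_sum u ((!) (eigvals T))"
    by (rule hermitian_spectral_sum)
  define m where "m = (!) (eigvals T)"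
  have T: "T = spectral_sum u m" using T_eig by (simp add: m_def)
  have m_pos: "0 < m j" if j: "j < CARD('d)" for j
  proof -
    have "m j = Re (cinner (T *v (u ! j)) (u ! j))"
      unfolding T using spectral_sum_basis[OF u j] orthonormalD[OF u(1), of j j] u(2) j
      by (simp add: cinner_simps)
    also have "\<dots> = Re (cinner ((ctranspose V ** V) *v (sqrt_op *v (u ! j))) (sqrt_op *v (u ! j)))"
      unfolding T_def conj_by_sqrt_form ..
    also have "\<dots> \<ge> (1 - \<delta>) * (norm (sqrt_op *v (u ! j)))\<^sup>2"
      by (rule spectral_norm_form_bounds[OF near])
    moreover have "sqrt_op *v (u ! j) \<noteq> 0"
    proof
      assume zero: "sqrt_op *v (u ! j) = 0"
      obtain B where "B ** sqrt_op = mat 1" using invertible_sqrt_op by (auto simp: invertible_def)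
      then have "u ! j = B *v (sqrt_op *v (u ! j))" by (simp add: matrix_vector_mul_assoc)
      then show False using zero norm_orthonormal[OF u(1)] u(2) j by force
    qed
    then have "0 < (1 - \<delta>) * (norm (sqrt_op *v (u ! j)))\<^sup>2" using \<delta> by simp
    ultimately show ?thesis by linarith
  qed
  have diag_u: "diag i = Re (cinner (spectral_sum u m *v (v ! i)) (v ! i))" for i
    by (simp add: diag_def T[symmetric])
  show "ln s + (\<Sum>i<CARD('d). ln (l i)) \<le> (\<Sum>i<CARD('d). ln (diag i))"
  proof -
    have prod_l: "0 < (\<Prod>i<CARD('d). l i)" using l by (intro prod_pos) auto
    have "of_real (\<Prod>j<CARD('d). m j) = det (ctranspose V ** V) * of_real (\<Prod>i<CARD('d). l i)"
      using det_conj_by_sqrt[of "ctranspose V ** V"] det_spectral_sum[OF u, of m]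
      unfolding T[symmetric] T_def[symmetric] by simp
    then have "(\<Prod>j<CARD('d). m j) = Re (det (ctranspose V ** V)) * (\<Prod>i<CARD('d). l i)"
      by (auto dest!: arg_cong[of _ _ Re] simp del: of_real_prod)
    then have "s * (\<Prod>i<CARD('d). l i) \<le> (\<Prod>j<CARD('d). m j)"
      using det prod_l by (simp add: mult_right_mono less_imp_le)
    then have "ln (s * (\<Prod>i<CARD('d). l i)) \<le> ln (\<Prod>j<CARD('d). m j)"
      using s prod_l by (intro ln_mono) auto
    moreover have "ln (\<Prod>i<CARD('d). l i) = (\<Sum>i<CARD('d). ln (l i))"
      "ln (\<Prod>j<CARD('d). m j) = (\<Sum>j<CARD('d). ln (m j))"
      using l m_pos by (auto intro!: ln_prod simp: less_imp_neq[symmetric])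
    ultimately have "ln s + (\<Sum>i<CARD('d). ln (l i)) \<le> (\<Sum>j<CARD('d). ln (m j))"
      using s prod_l by (simp add: ln_mult_pos)
    also have "\<dots> \<le> (\<Sum>i<CARD('d). ln (diag i))"
    proof -
      have "(\<Sum>i<CARD('d). - ln (diag i)) \<le> (\<Sum>j<CARD('d). - ln (m j))"
      \<comment> \<open>Hadamard's inequality: the slopes are those of the tangents of \<open>- ln\<close> at the diagonal.\<close>
      proof (rule sum_diag_le_sum_eigvals[OF u v diag_u, where k = "\<lambda>i. - 1 / diag i"])
        fix i j assume ij: "i < CARD('d)" "j < CARD('d)"
        have "ln (m j) - ln (diag i) = ln (m j / diag i)"
          using m_pos[OF ij(2)] diag_pos[OF ij(1)] by (simp add: ln_div)
        also have "\<dots> \<le> m j / diag i - 1"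
          using m_pos[OF ij(2)] diag_pos[OF ij(1)] by (intro ln_le_minus_one) simp
        finally show "- ln (diag i) + - 1 / diag i * (m j - diag i) \<le> - ln (m j)"
          using diag_pos[OF ij(1)] by (simp add: field_simps)
      qed
      then show ?thesis by (simp add: sum_negf)
    qed
    finally show ?thesis .
  qed
  have eig_sum: "(\<Sum>x\<leftarrow>eigvals T. h x) = (\<Sum>j<CARD('d). h (m j))" for h :: "real \<Rightarrow> real"
    unfolding T eigvals_spectral_sum[OF u] by (rule sum_list_decr_upt)
  assume h: "convex_on {0..} h"
  have "\<exists>k. \<forall>y\<in>{0..}. h (diag i) + k * (y - diag i) \<le> h y" if "i < CARD('d)" for i
    using convex_on_obtains_tangent[OF h diag_pos[OF that]] by metis
  then obtain k where k: "\<And>i y. i < CARD('d) \<Longrightarrow> y \<in> {0..} \<Longrightarrow> h (diag i) + k i * (y - diag i) \<le> h y"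
    by metis
  show "(\<Sum>i<CARD('d). h (diag i)) \<le> (\<Sum>x\<leftarrow>eigvals T. h x)"
    unfolding eig_sum using k m_pos
    by (intro sum_diag_le_sum_eigvals[OF u v diag_u, where k = k]) (auto simp: less_imp_le)
  assume strict: "strictly_convex_on {0..} h"
    and eq: "(\<Sum>x\<leftarrow>eigvals T. h x) = (\<Sum>i<CARD('d). h (diag i))"
  have "spectral_sum u m = spectral_sum v diag"
  proof (rule diagonal_if_sum_eq[OF u v diag_u, where k = k and g = h])
    fix i j assume ij: "i < CARD('d)" "j < CARD('d)" "m j \<noteq> diag i"
    then have "k i * (m j - diag i) < h (m j) - h (diag i)"
      using m_pos[OF ij(2)] diag_pos[OF ij(1)]
      by (intro strictly_convex_on_tangent_slope[OF h strict k[OF ij(1)]]) auto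
    then show "h (diag i) + k i * (m j - diag i) < h (m j)" by simp
  next
    show "(\<Sum>j<CARD('d). h (m j)) = (\<Sum>i<CARD('d). h (diag i))" using eq by (simp add: eig_sum)
  qed
  then show "T = spectral_sum v diag" by (simp add: T)
qed

lemma convex_potential_act:
  fixes V :: "complex^'d^'d"
  assumes "frame_op F = spectral_sum v l" "invertible V"
  shows "convex_potential h (act V F) = (\<Sum>x\<leftarrow>eigvals (conj_by_sqrt (ctranspose V ** V)). h x)"
  using eigvals_perturbed[OF assms(2)] assms(1) by (simp add: convex_potential_def frame_op_act)

lemma convex_potential_act_diagonal:
  fixes V :: "complex^'d^'d"
  assumes "frame_op F = spectral_sum v l" "invertible V"
    and "ctranspose V ** V = spectral_sum v (\<lambda>i. m i / l i)"
  shows "convex_potential h (act V F) = (\<Sum>i<CARD('d). h (m i))"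
proof -
  have "conj_by_sqrt (ctranspose V ** V) = spectral_sum v m"
    using assms(3) by (simp add: conj_by_sqrt_eq_iff)
  then show ?thesis
    by (simp add: convex_potential_act[OF assms(1,2)] eigvals_spectral_sum[OF v] sum_list_decr_upt)
qed

end

theorem corollary5p6:
  fixes F :: "(complex^'d) list"
    and \<delta> s t \<epsilon> :: real
    and lam \<rho> \<mu> :: "real list"
    and h :: "real \<Rightarrow> real"
  assumes "is_frame F"
    and "0 < \<delta>" "\<delta> < 1"
    and "0 < s" "(1 - \<delta>) ^ CARD('d) \<le> s" "s \<le> (1 + \<delta>) ^ CARD('d)"
    and "lam = map ln (eigvals (frame_op F))"
    and "t = ln (s * Re (det (frame_op F)) / (1 - \<delta>) ^ CARD('d))"
    and "\<epsilon> = ln ((1 + \<delta>) / (1 - \<delta>))"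
    and "\<rho> = rho_opt t \<epsilon> lam"
    and "\<mu> = map (\<lambda>r. (1 - \<delta>) * exp r) \<rho>"
    and "\<forall>x\<ge>0. 0 \<le> h x" "mono_on {0..} h" "convex_on {0..} h"
  shows "(\<forall>G\<in>perturbations s \<delta> F. convex_potential h G \<ge> (\<Sum>m\<leftarrow>\<mu>. h m)) \<and>
         (\<exists>G\<in>perturbations s \<delta> F. convex_potential h G = (\<Sum>m\<leftarrow>\<mu>. h m)) \<and>
         (strictly_convex_on {0..} h \<longrightarrow>
           (\<forall>V. act V F \<in> perturbations s \<delta> F \<longrightarrow>
             (convex_potential h (act V F) = (\<Sum>m\<leftarrow>\<mu>. h m) \<longleftrightarrow>
               det (ctranspose V ** V) = complex_of_real s \<and>
               (\<exists>v. is_onb v \<and>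
                  frame_op F =
                    (\<Sum>i<CARD('d). eigvals (frame_op F) ! i *\<^sub>R tensor (v ! i) (v ! i)) \<and>
                  ctranspose V ** V =
                    (\<Sum>i<CARD('d). (\<mu> ! i / eigvals (frame_op F) ! i)
                       *\<^sub>R tensor (v ! i) (v ! i))))))"
proof -
  define e where "e = eigvals (frame_op F)"
  obtain v where v: "orthonormal v" "length v = CARD('d)" and S: "frame_op F = spectral_sum v ((!) e)"
    using hermitian_spectral_sum[OF ctranspose_frame_op, of F] unfolding e_def by metis
  have len: "length e = CARD('d)"
    by (metis S e_def eigvals_spectral_sum[OF v] length_decr length_map length_upt diff_zero)
  have pos: "0 < e ! i" if "i < CARD('d)" for i
  proof -
    have "norm (v ! i) = 1" using that v by (simp add: norm_orthonormal)
    then have "0 < Re (cinner (frame_op F *v (v ! i)) (v ! i))"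
      by (intro frame_op_positive assms) auto
    then show ?thesis using that \<open>norm (v ! i) = 1\<close>
      by (simp add: S spectral_sum_basis[OF v] cinner_simps cinner_self del: of_real_power)
  qed
  have det_S: "Re (det (frame_op F)) = (\<Prod>i<CARD('d). e ! i)"
    by (simp add: S det_spectral_sum[OF v] del: of_real_prod)
  obtain C where C: "0 < C" and len_\<mu>: "length \<mu> = CARD('d)"
    and \<mu>_bounds: "\<And>i. i < CARD('d) \<Longrightarrow> (1 - \<delta>) * e ! i \<le> \<mu> ! i \<and> \<mu> ! i \<le> (1 + \<delta>) * e ! i"
    and between: "\<And>i x. i < CARD('d) \<Longrightarrow> (1 - \<delta>) * e ! i \<le> x \<Longrightarrow> x \<le> (1 + \<delta>) * e ! i \<Longrightarrow>
        C \<le> \<mu> ! i \<and> \<mu> ! i \<le> x \<or> x \<le> \<mu> ! i \<and> \<mu> ! i \<le> C"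
    and \<mu>_logs: "(\<Sum>i<CARD('d). ln (\<mu> ! i)) = ln s + (\<Sum>i<CARD('d). ln (e ! i))"
  proof (rule optimal_spectrum[of e \<delta> s lam t \<epsilon> \<rho> \<mu>])
    show "sorted_wrt (\<ge>) e" unfolding e_def by (rule sorted_wrt_eigvals)
    show "e \<noteq> []" using len by auto
  qed (use assms len pos det_S in \<open>simp_all add: e_def\<close>)
  have sum_\<mu>: "(\<Sum>m\<leftarrow>\<mu>. h m) = (\<Sum>i<CARD('d). h (\<mu> ! i))"
    by (simp add: sum_list_sum_nth len_\<mu> atLeast0LessThan)
  have \<mu>_pos: "0 < \<mu> ! i" if "i < CARD('d)" for i
  proof -
    have "0 < (1 - \<delta>) * e ! i" using pos[OF that] assms by simp
    then show ?thesis using \<mu>_bounds[OF that] by linarith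
  qed
  have \<mu>_prod: "(\<Prod>i<CARD('d). \<mu> ! i / e ! i) = s"
  proof -
    have quot: "0 < \<mu> ! i / e ! i" if "i < CARD('d)" for i using that \<mu>_pos pos by simp
    have "ln (\<Prod>i<CARD('d). \<mu> ! i / e ! i) = (\<Sum>i<CARD('d). ln (\<mu> ! i / e ! i))"
      using quot by (intro ln_prod less_imp_neq[symmetric]) auto
    also have "\<dots> = (\<Sum>i<CARD('d). ln (\<mu> ! i) - ln (e ! i))"
      using \<mu>_pos pos by (intro sum.cong) (auto simp: ln_divide_pos)
    also have "\<dots> = ln s" by (simp add: sum_subtractf \<mu>_logs)
    finally show ?thesis
      using assms(4) prod_pos[of "{..<CARD('d)}" "\<lambda>i. \<mu> ! i / e ! i"] quot
      by simp
  qed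
  \<comment> \<open>Stated for an arbitrary eigenbasis \<open>w\<close> of the frame operator, since the characterisation of
    the minimisers only asserts the existence of one.\<close>
  have diagonal_attains: "convex_potential h (act V F) = (\<Sum>m\<leftarrow>\<mu>. h m)"
    if w: "orthonormal w" "length w = CARD('d)" "frame_op F = spectral_sum w ((!) e)"
      and V: "invertible V" "ctranspose V ** V = spectral_sum w (\<lambda>i. \<mu> ! i / e ! i)" for w V
  proof -
    interpret positive_spectrum w "(!) e" using w pos by unfold_locales auto
    show ?thesis using convex_potential_act_diagonal[OF w(3) V] by (simp add: sum_\<mu>)
  qed
  interpret positive_spectrum v "(!) e" using v pos by unfold_locales auto
  \<comment> \<open>The diagonal of \<open>?T\<close> in the basis \<open>v\<close> interpolates: its \<open>h\<close>-sum is at least that of \<open>\<mu>\<close> and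
    at most the potential, and equality of the outer two passes to both comparisons.\<close>
  have lower: "(\<Sum>m\<leftarrow>\<mu>. h m) \<le> convex_potential h (act V F)"
    and rigid: "strictly_convex_on {0..} h \<Longrightarrow> convex_potential h (act V F) = (\<Sum>m\<leftarrow>\<mu>. h m) \<Longrightarrow>
      ctranspose V ** V = spectral_sum v (\<lambda>i. \<mu> ! i / e ! i)"
    if V: "invertible V" "spectral_norm (ctranspose V ** V - mat 1) \<le> \<delta>"
      "s \<le> Re (det (ctranspose V ** V))" for V
  proof -
    let ?T = "conj_by_sqrt (ctranspose V ** V)"
    define diag where "diag i = Re (cinner (?T *v (v ! i)) (v ! i))" for i
    note facts = conj_by_sqrt_diag_facts[OF diag_def assms(2,3,4) V(2,3)]
    have pair_pos: "0 < diag i \<and> 0 < \<mu> ! i" if "i < CARD('d)" for i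
    proof -
      have "0 < (1 - \<delta>) * e ! i" using pos[OF that] assms by simp
      then show ?thesis using facts(1)[OF that] \<mu>_pos[OF that] by linarith
    qed
    have diag_between: "C \<le> \<mu> ! i \<and> \<mu> ! i \<le> diag i \<or> diag i \<le> \<mu> ! i \<and> \<mu> ! i \<le> C"
      if "i < CARD('d)" for i
      using facts(1)[OF that] between[OF that] by blast
    have logs: "(\<Sum>i<CARD('d). ln (\<mu> ! i)) \<le> (\<Sum>i<CARD('d). ln (diag i))"
      using facts(2) by (simp add: \<mu>_logs)
    have step: "(\<Sum>i<CARD('d). h (\<mu> ! i)) \<le> (\<Sum>i<CARD('d). h (diag i))"
      using pair_pos diag_between by (intro sum_convex_log_le(1)[OF assms(14,13) C _ _ logs]) auto
    have pot: "convex_potential h (act V F) = (\<Sum>x\<leftarrow>eigvals ?T. h x)"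
      by (rule convex_potential_act[OF S V(1)])
    show "(\<Sum>m\<leftarrow>\<mu>. h m) \<le> convex_potential h (act V F)"
      using step facts(3)[OF assms(14)] by (simp add: pot sum_\<mu>)
    assume strict: "strictly_convex_on {0..} h" and eq: "convex_potential h (act V F) = (\<Sum>m\<leftarrow>\<mu>. h m)"
    have eq1: "(\<Sum>x\<leftarrow>eigvals ?T. h x) = (\<Sum>i<CARD('d). h (diag i))"
      and eq2: "(\<Sum>i<CARD('d). h (diag i)) = (\<Sum>i<CARD('d). h (\<mu> ! i))"
      using eq step facts(3)[OF assms(14)] by (simp_all add: pot sum_\<mu>)
    have "diag i = \<mu> ! i" if "i < CARD('d)" for i
      using pair_pos diag_between that
      by (intro sum_convex_log_le(2)[OF assms(14,13) C _ _ logs _ strict eq2]) auto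
    then have "spectral_sum v diag = spectral_sum v ((!) \<mu>)" by (rule spectral_sum_cong)
    then have "?T = spectral_sum v ((!) \<mu>)"
      using facts(4)[OF assms(14) strict eq1] by simp
    then show "ctranspose V ** V = spectral_sum v (\<lambda>i. \<mu> ! i / e ! i)"
      by (simp add: conj_by_sqrt_eq_iff)
  qed
  \<comment> \<open>The positive square root of the optimal \<open>V\<^sup>*V\<close> attains the bound.\<close>
  define V0 where "V0 = spectral_sum v (\<lambda>i. sqrt (\<mu> ! i / e ! i))"
  have V0: "ctranspose V0 ** V0 = spectral_sum v (\<lambda>i. \<mu> ! i / e ! i)"
    unfolding V0_def ctranspose_spectral_sum spectral_sum_mult[OF v]
    using \<mu>_pos pos by (intro spectral_sum_cong) (simp add: less_imp_le)
  have V0_invertible: "invertible V0"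
    unfolding V0_def using \<mu>_pos pos by (intro spectral_sum_invertible[OF v] less_imp_neq[symmetric]) simp
  have "spectral_norm (ctranspose V0 ** V0 - mat 1) \<le> \<delta>"
  proof -
    have "ctranspose V0 ** V0 - mat 1 = spectral_sum v (\<lambda>i. \<mu> ! i / e ! i - 1)"
      unfolding V0 spectral_sum_one[OF v, symmetric]
      by (simp add: spectral_sum_def sum_subtractf scaleR_left_diff_distrib)
    also have "spectral_norm \<dots> \<le> \<delta>"
    proof (rule spectral_norm_spectral_sum_le[OF v])
      show "\<bar>\<mu> ! i / e ! i - 1\<bar> \<le> \<delta>" if "i < CARD('d)" for i
        using \<mu>_bounds[OF that] pos[OF that] by (auto simp: abs_le_iff field_simps)
    qed (use assms in simp)
    finally show ?thesis .
  qed
  moreover have det_optimal: "det (spectral_sum v (\<lambda>i. \<mu> ! i / e ! i)) = complex_of_real s"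
    unfolding det_spectral_sum[OF v] \<mu>_prod ..
  ultimately have V0_mem: "act V0 F \<in> perturbations s \<delta> F"
    using V0_invertible unfolding perturbations_def
    by (intro CollectI exI[of _ V0]) (simp add: V0)
  show ?thesis
  proof (intro conjI impI ballI allI)
    fix G assume "G \<in> perturbations s \<delta> F"
    then show "(\<Sum>m\<leftarrow>\<mu>. h m) \<le> convex_potential h G"
      using lower by (auto simp: perturbations_def)
  next
    show "\<exists>G\<in>perturbations s \<delta> F. convex_potential h G = (\<Sum>m\<leftarrow>\<mu>. h m)"
      using V0_mem diagonal_attains[OF v S V0_invertible V0] by blast
  next
    fix V assume strict: "strictly_convex_on {0..} h" and "act V F \<in> perturbations s \<delta> F"
    then have V: "invertible V" "spectral_norm (ctranspose V ** V - mat 1) \<le> \<delta>"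
      "s \<le> Re (det (ctranspose V ** V))"
      using act_inj[OF assms(1), of V] by (auto simp: perturbations_def)
    show "convex_potential h (act V F) = (\<Sum>m\<leftarrow>\<mu>. h m) \<longleftrightarrow>
       det (ctranspose V ** V) = complex_of_real s \<and>
       (\<exists>v. is_onb v \<and>
          frame_op F = (\<Sum>i<CARD('d). eigvals (frame_op F) ! i *\<^sub>R tensor (v ! i) (v ! i)) \<and>
          ctranspose V ** V = (\<Sum>i<CARD('d). (\<mu> ! i / eigvals (frame_op F) ! i) *\<^sub>R tensor (v ! i) (v ! i)))"
      unfolding is_onb_iff_orthonormal e_def[symmetric]
      unfolding spectral_sum_def[symmetric]
    proof
      assume "convex_potential h (act V F) = (\<Sum>m\<leftarrow>\<mu>. h m)"
      then have "ctranspose V ** V = spectral_sum v (\<lambda>i. \<mu> ! i / e ! i)"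
        by (rule rigid[OF V strict])
      then show "det (ctranspose V ** V) = complex_of_real s \<and>
        (\<exists>v. (orthonormal v \<and> length v = CARD('d)) \<and> frame_op F = spectral_sum v ((!) e) \<and>
          ctranspose V ** V = spectral_sum v (\<lambda>i. \<mu> ! i / e ! i))"
        using v S det_optimal by metis
    next
      assume "det (ctranspose V ** V) = complex_of_real s \<and>
        (\<exists>v. (orthonormal v \<and> length v = CARD('d)) \<and> frame_op F = spectral_sum v ((!) e) \<and>
          ctranspose V ** V = spectral_sum v (\<lambda>i. \<mu> ! i / e ! i))"
      then show "convex_potential h (act V F) = (\<Sum>m\<leftarrow>\<mu>. h m)"
        using diagonal_attains V(1) by blast
    qed
  qed
qed

end
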